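(* Let $T:(x_1,x_2,X,y_1,y_2,Y,z_1,z_2,Z)\mapsto(u_1,u_2,U,v_1,v_2,V,w_1,w_2,W)$ be the nine-dimensional rational map given by $$u_1=\frac{x_1(y_1y_2-Y)+y_1z_2}{z_1z_2-Z},\quad u_2=\frac{(x_1x_2-X)(y_2z_1X+x_2Z)(z_1z_2-Z)}{\Delta},\quad U=\frac{(x_1x_2-X)(z_1z_2-Z)XY}{\Delta},$$ $$v_1=\frac{x_1z_1(y_1y_2-Y)+y_1Z}{(x_1x_2-X)(z_1z_2-Z)},\quad v_2=x_2z_2+y_2X,\quad V=\frac{\Delta}{(x_1x_2-X)(z_1z_2-Z)},$$ $$w_1=\frac{[x_2y_1Z+z_1(y_1y_2-Y)X](z_1z_2-Z)}{\Delta},\quad w_2=x_1y_2+z_2,\quad W=\frac{(x_1x_2-X)(z_1z_2-Z)YZ}{\Delta},$$ where $\Delta=y_1y_2z_1(x_1y_2+z_2)X-(x_1y_2z_1+z_1z_2-Z)XY+x_2[y_1z_2+x_1(y_1y_2-Y)]Z$. 1. The quantities $\Phi=X-x_1x_2$, $\Psi=Y-y_1y_2$ and $\Omega=Z-z_1z_2$ are invariants of $T$. 2. For nonzero $a,b,c\in\mathbb C$, the map $T$ can be restricted, on the invariant leaves $$A_a=\{(x_1,x_2,X)\in\mathbb C^3: X=a+x_1x_2\},\quad B_b=\{(y_1,y_2,Y)\in\mathbb C^3: Y=b+y_1y_2\},\quad C_c=\{(z_1,z_2,Z)\in\mathbb C^3: Z=c+z_1z_2\},$$ to a noninvolutive parametric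 six-dimensional tetrahedron map $T_{a,b,c}:(x_1,x_2,y_1,y_2,z_1,z_2)\mapsto(u_1,u_2,v_1,v_2,w_1,w_2)$ given by $$u_1=\frac{bx_1-y_1z_2}{c},\qquad u_2=\frac{ac[x_2(c+z_1z_2)+y_2z_1(a+x_1x_2)]}{abc-[x_2z_2+y_2(a+x_1x_2)][bx_1z_1-y_1(c+z_1z_2)]},$$ $$v_1=\frac{y_1(c+z_1z_2)-bx_1z_1}{ac},\qquad v_2=x_2z_2+y_2(a+x_1x_2),$$ $$w_1=\frac{c[bz_1(a+x_1x_2)-x_2y_1(c+z_1z_2)]}{abc-[x_2z_2+y_2(a+x_1x_2)][bx_1z_1-y_1(c+z_1z_2)]},\qquad w_2=x_1y_2+z_2.$$ 3. The map $T_{a,b,c}$ admits the invariants $$I_1=(a+x_1x_2)(b+y_1y_2),\qquad I_2=(b+y_1y_2)(c+z_1z_2),\qquad I_3=ay_1y_2+(x_2y_1+z_1)(x_1y_2+z_2).$$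
   Context: All maps are rational maps and identities between them are understood as identities of rational functions. A function $I$ is an invariant of a map if its value at the image point (i.e. with $x_i,y_i,z_i,X,Y,Z$ replaced by $u_i,v_i,w_i,U,V,W$) equals its value at the original point. Parametric tetrahedron map: a family of rational maps $T_{a,b,c}:\mathcal X^3\to\mathcal X^3$ depending on parameters $a,b,c$ is a parametric tetrahedron map if $$T^{123}_{a,b,c}\circ T^{145}_{a,d,e}\circ T^{246}_{b,d,f}\circ T^{356}_{c,e,f}=T^{356}_{c,e,f}\circ T^{246}_{b,d,f}\circ T^{145}_{a,d,e}\circ T^{123}_{a,b,c}$$ on $\mathcal X^6$ for all parameters $a,b,c,d,e,f$, where $T^{ijk}$ acts as $T$ on the $i$-th, $j$-th, $k$-th factors (in this order) of $\mathcal X^6$ and as the identity on the others. Here $\mathcal X=\mathbb C^2$, with the three factors having coordinates $(x_1,x_2)$, $(y_1,y_2)$, $(z_1,z_2)$ and the image $(u_1,u_2)$, $(v_1,v_2)$, $(w_1,w_2)$. Noninvolutive means $T_{a,b,c}\circ T_{a,b,c}\neq\mathrm{id}$. Restriction to the leaves means: $T$ maps $A_a\times B_b\times C_c$ to itself, and $T_{a,b,c}$ is the induced map in the coordinates $(x_1,x_2,y_1,y_2,z_1,z_2)$. *)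

theory Defs
  imports Complex_Main "HOL-Library.Poly_Mapping" "HOL-Computational_Algebra.Fraction_Field"
begin

text \<open>
  Rational functions over the complex numbers are elements of the fraction field of the ring of
  complex polynomials in the variables number 0, 1, 2, ... (only finitely many occur in each
  polynomial), so an equation between them is an identity of rational functions.
\<close>

type_synonym cpoly = "(nat \<Rightarrow>\<^sub>0 nat) \<Rightarrow>\<^sub>0 complex"
type_synonym ratfun = "cpoly fract"

definition const :: "complex \<Rightarrow> ratfun" where
  "const c = Fract (Poly_Mapping.single 0 c) 1"

definition var :: "nat \<Rightarrow> ratfun" where
  "var i = Fract (Poly_Mapping.single (Poly_Mapping.single i 1) 1) 1"

text \<open>
  Evaluation at a point \<open>\<sigma>\<close> with coordinates in a field extension of the complex numbers,
  the embedding being given by \<open>h\<close>. It is used for \<open>h = id\<close> (values at complex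
  points) and for \<open>h = const\<close> (substitution of rational functions for the variables).
\<close>

definition poly_value :: "(complex \<Rightarrow> 'k) \<Rightarrow> (nat \<Rightarrow> 'k) \<Rightarrow> cpoly \<Rightarrow> 'k::field" where
  "poly_value h \<sigma> p =
     (\<Sum>m\<in>Poly_Mapping.keys p. h (Poly_Mapping.lookup p m) *
        (\<Prod>i\<in>Poly_Mapping.keys m. \<sigma> i ^ Poly_Mapping.lookup m i))"

text \<open>
  A rational function is regular at \<open>\<sigma>\<close> if some representation of it as a quotient has a
  denominator that does not vanish at \<open>\<sigma>\<close>; its value there is independent of the
  representation (lemma \<open>has_value_unique\<close>).
\<close>

definition has_value :: "(complex \<Rightarrow> 'k) \<Rightarrow> (nat \<Rightarrow> 'k) \<Rightarrow> ratfun \<Rightarrow> 'k::field \<Rightarrow> bool" where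
  "has_value h \<sigma> f v \<longleftrightarrow>
     (\<exists>p q. f = Fract p q \<and> poly_value h \<sigma> q \<noteq> 0 \<and> v = poly_value h \<sigma> p / poly_value h \<sigma> q)"

definition rat_value :: "(complex \<Rightarrow> 'k) \<Rightarrow> (nat \<Rightarrow> 'k) \<Rightarrow> ratfun \<Rightarrow> 'k::field option" where
  "rat_value h \<sigma> f =
     (if \<exists>v. has_value h \<sigma> f v then Some (THE v. has_value h \<sigma> f v) else None)"

text \<open>
  A rational map from complex n-space to complex m-space is the list of its m components, which
  are rational functions of the variables with number less than n. Values at complex points and
  compositions are \<open>None\<close> if some component is not regular at the given point or tuple.
\<close>

type_synonym ratmap = "ratfun list"

definition is_ratmap :: "nat \<Rightarrow> nat \<Rightarrow> ratmap \<Rightarrow> bool" where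
  "is_ratmap n m F \<longleftrightarrow> length F = m \<and>
     (\<forall>f\<in>set F. \<exists>p q. f = Fract p q \<and> q \<noteq> 0 \<and>
        (\<forall>k \<in> Poly_Mapping.keys p \<union> Poly_Mapping.keys q. Poly_Mapping.keys k \<subseteq> {..<n}))"

definition map_at :: "ratmap \<Rightarrow> complex list \<Rightarrow> complex list option" where
  "map_at F p = those (map (rat_value id ((!) p)) F)"

definition comp_map :: "ratmap \<Rightarrow> ratmap \<Rightarrow> ratmap option" where
  "comp_map F G = those (map (rat_value const ((!) G)) F)"

definition id_map :: "nat \<Rightarrow> ratmap" where
  "id_map n = map var [0..<n]"

text \<open>\<open>composite n [F\<^sub>1, \<dots>, F\<^sub>k]\<close> is \<open>F\<^sub>1 \<circ> \<dots> \<circ> F\<^sub>k\<close> on complex n-space.\<close>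

definition composite :: "nat \<Rightarrow> ratmap list \<Rightarrow> ratmap option" where
  "composite n Fs = foldr (\<lambda>F G. Option.bind G (comp_map F)) Fs (Some (id_map n))"

definition invariant_of :: "ratfun \<Rightarrow> ratmap \<Rightarrow> bool" where
  "invariant_of I F \<longleftrightarrow> rat_value const ((!) F) I = Some I"

definition noninvolutive :: "nat \<Rightarrow> ratmap \<Rightarrow> bool" where
  "noninvolutive n F \<longleftrightarrow> (\<exists>G. composite n [F, F] = Some G \<and> G \<noteq> id_map n)"

text \<open>
  \<open>act_on T i j k\<close> is the map $T^{ijk}$ on six factors, numbered from 1, each of them being the
  complex plane with two coordinates. The composition in its definition only renames variables and
  is therefore defined for all components.
\<close>

definition factor :: "nat \<Rightarrow> ratmap" where
  "factor s = [var (2 * (s - 1)), var (2 * (s - 1) + 1)]"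

definition act_on :: "ratmap \<Rightarrow> nat \<Rightarrow> nat \<Rightarrow> nat \<Rightarrow> ratmap" where
  "act_on T i j k =
     (let t = the (comp_map T (factor i @ factor j @ factor k))
      in concat (map (\<lambda>s. if s = i then [t ! 0, t ! 1]
                          else if s = j then [t ! 2, t ! 3]
                          else if s = k then [t ! 4, t ! 5]
                          else factor s) [1..<7]))"

definition parametric_tetrahedron_map ::
    "complex set \<Rightarrow> (complex \<Rightarrow> complex \<Rightarrow> complex \<Rightarrow> ratmap) \<Rightarrow> bool" where
  "parametric_tetrahedron_map P T \<longleftrightarrow>
     (\<forall>a\<in>P. \<forall>b\<in>P. \<forall>c\<in>P. is_ratmap 6 6 (T a b c)) \<and>
     (\<forall>a\<in>P. \<forall>b\<in>P. \<forall>c\<in>P. \<forall>d\<in>P. \<forall>e\<in>P. \<forall>f\<in>P.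
        \<exists>G. composite 12 [act_on (T a b c) 1 2 3, act_on (T a d e) 1 4 5,
                          act_on (T b d f) 2 4 6, act_on (T c e f) 3 5 6] = Some G \<and>
            composite 12 [act_on (T c e f) 3 5 6, act_on (T b d f) 2 4 6,
                          act_on (T a d e) 1 4 5, act_on (T a b c) 1 2 3] = Some G)"

text \<open>
  \<open>F\<close> restricts to a map of \<open>S\<close> to itself, given in the coordinates \<open>\<chi>\<close> on \<open>S\<close> by the
  rational map \<open>G\<close>: \<open>F\<close> is defined at some point of \<open>S\<close>, and at every such point its value lies in
  \<open>S\<close> and is described by \<open>G\<close>. (For the leaves below, \<open>S\<close> is an irreducible affine space with
  coordinates \<open>\<chi>\<close>, so this determines \<open>G\<close> as a rational map.)
\<close>

definition restricts_to ::
    "ratmap \<Rightarrow> complex list set \<Rightarrow> (complex list \<Rightarrow> complex list) \<Rightarrow> ratmap \<Rightarrow> bool" where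
  "restricts_to F S \<chi> G \<longleftrightarrow>
     (\<exists>p\<in>S. map_at F p \<noteq> None) \<and>
     (\<forall>p\<in>S. \<forall>q. map_at F p = Some q \<longrightarrow> q \<in> S \<and> map_at G (\<chi> p) = Some (\<chi> q))"

text \<open>The leaves $A_a$, $B_b$, $C_c$ are the same subset of complex 3-space, for different
  values of the parameter.\<close>

definition leaf :: "complex \<Rightarrow> (complex \<times> complex \<times> complex) set" where
  "leaf d = {(s, t, R). R = d + s * t}"

definition leaf_product :: "complex \<Rightarrow> complex \<Rightarrow> complex \<Rightarrow> complex list set" where
  "leaf_product a b c =
     {[x1, x2, X, y1, y2, Y, z1, z2, Z] | x1 x2 X y1 y2 Y z1 z2 Z.
        (x1, x2, X) \<in> leaf a \<and> (y1, y2, Y) \<in> leaf b \<and> (z1, z2, Z) \<in> leaf c}"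

definition leaf_coords :: "complex list \<Rightarrow> complex list" where
  "leaf_coords p = [p ! 0, p ! 1, p ! 3, p ! 4, p ! 6, p ! 7]"

definition T9 :: ratmap where
  "T9 =
    (let x1 = var 0; x2 = var 1; X = var 2;
         y1 = var 3; y2 = var 4; Y = var 5;
         z1 = var 6; z2 = var 7; Z = var 8;
         \<Delta> = y1 * y2 * z1 * (x1 * y2 + z2) * X - (x1 * y2 * z1 + z1 * z2 - Z) * X * Y
             + x2 * (y1 * z2 + x1 * (y1 * y2 - Y)) * Z
     in [(x1 * (y1 * y2 - Y) + y1 * z2) / (z1 * z2 - Z),
         (x1 * x2 - X) * (y2 * z1 * X + x2 * Z) * (z1 * z2 - Z) / \<Delta>,
         (x1 * x2 - X) * (z1 * z2 - Z) * X * Y / \<Delta>,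
         (x1 * z1 * (y1 * y2 - Y) + y1 * Z) / ((x1 * x2 - X) * (z1 * z2 - Z)),
         x2 * z2 + y2 * X,
         \<Delta> / ((x1 * x2 - X) * (z1 * z2 - Z)),
         (x2 * y1 * Z + z1 * (y1 * y2 - Y) * X) * (z1 * z2 - Z) / \<Delta>,
         x1 * y2 + z2,
         (x1 * x2 - X) * (z1 * z2 - Z) * Y * Z / \<Delta>])"

definition \<Phi>9 :: ratfun where "\<Phi>9 = var 2 - var 0 * var 1"
definition \<Psi>9 :: ratfun where "\<Psi>9 = var 5 - var 3 * var 4"
definition \<Omega>9 :: ratfun where "\<Omega>9 = var 8 - var 6 * var 7"

definition T6 :: "complex \<Rightarrow> complex \<Rightarrow> complex \<Rightarrow> ratmap" where
  "T6 a' b' c' =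
    (let x1 = var 0; x2 = var 1; y1 = var 2; y2 = var 3; z1 = var 4; z2 = var 5;
         a = const a'; b = const b'; c = const c';
         D = a * b * c - (x2 * z2 + y2 * (a + x1 * x2)) * (b * x1 * z1 - y1 * (c + z1 * z2))
     in [(b * x1 - y1 * z2) / c,
         a * c * (x2 * (c + z1 * z2) + y2 * z1 * (a + x1 * x2)) / D,
         (y1 * (c + z1 * z2) - b * x1 * z1) / (a * c),
         x2 * z2 + y2 * (a + x1 * x2),
         c * (b * z1 * (a + x1 * x2) - x2 * y1 * (c + z1 * z2)) / D,
         x1 * y2 + z2])"

definition I1 :: "complex \<Rightarrow> complex \<Rightarrow> complex \<Rightarrow> ratfun" where
  "I1 a b c = (const a + var 0 * var 1) * (const b + var 2 * var 3)"

definition I2 :: "complex \<Rightarrow> complex \<Rightarrow> complex \<Rightarrow> ratfun" where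
  "I2 a b c = (const b + var 2 * var 3) * (const c + var 4 * var 5)"

definition I3 :: "complex \<Rightarrow> complex \<Rightarrow> complex \<Rightarrow> ratfun" where
  "I3 a b c = const a * var 2 * var 3 + (var 1 * var 2 + var 4) * (var 0 * var 3 + var 5)"


subsection \<open>Well-definedness of values\<close>

lemma poly_value_superset:
  assumes "finite S" "Poly_Mapping.keys p \<subseteq> S" "h 0 = 0"
  shows "poly_value h \<sigma> p =
     (\<Sum>m\<in>S. h (Poly_Mapping.lookup p m) *
        (\<Prod>i\<in>Poly_Mapping.keys m. \<sigma> i ^ Poly_Mapping.lookup m i))"
  unfolding poly_value_def
  by (rule sum.mono_neutral_left) (use assms in \<open>auto simp: in_keys_iff\<close>)

lemma cpoly_induct [case_names single add]:
  fixes p :: cpoly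
  assumes single: "\<And>m c. P (Poly_Mapping.single m c)"
    and add: "\<And>p q. P p \<Longrightarrow> P q \<Longrightarrow> P (p + q)"
  shows "P p"
proof (induction p rule: update_induct)
  case const
  show ?case using single[of 0 0] by simp
next
  case (update p m c)
  have "Poly_Mapping.update m c p = p + Poly_Mapping.single m c"
    using update(1)
    by (intro poly_mapping_eqI) (auto simp: lookup_update lookup_add lookup_single when_def in_keys_iff)
  then show ?case using add update single by simp
qed

locale embedding =
  fixes h :: "complex \<Rightarrow> 'k::field"
  assumes h_add: "h (x + y) = h x + h y" and h_mult: "h (x * y) = h x * h y" and h_one: "h 1 = 1"
begin

lemma h_zero: "h 0 = 0"
  by (metis h_add add.right_neutral add_cancel_right_right)

lemma h_minus: "h (- x) = - h x"
  by (metis h_add h_zero add.right_inverse add_eq_0_iff2 minus_unique)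

lemma poly_value_add: "poly_value h \<sigma> (p + q) = poly_value h \<sigma> p + poly_value h \<sigma> q"
proof -
  let ?S = "Poly_Mapping.keys p \<union> Poly_Mapping.keys q"
  have *: "finite ?S" "Poly_Mapping.keys (p + q) \<subseteq> ?S"
    by (auto simp: Poly_Mapping.keys_add)
  show ?thesis
    by (simp add: poly_value_superset[of ?S, OF *(1)] *(2) h_zero lookup_add h_add
        algebra_simps sum.distrib)
qed

lemma poly_value_single:
  "poly_value h \<sigma> (Poly_Mapping.single m c) =
     h c * (\<Prod>i\<in>Poly_Mapping.keys m. \<sigma> i ^ Poly_Mapping.lookup m i)"
  by (subst poly_value_superset[of "{m}"]) (auto simp: h_zero)

lemma monomial_value_add:
  "(\<Prod>i\<in>Poly_Mapping.keys (m + n). (\<sigma> i :: 'k) ^ Poly_Mapping.lookup (m + n) i) =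
   (\<Prod>i\<in>Poly_Mapping.keys m. \<sigma> i ^ Poly_Mapping.lookup m i) *
   (\<Prod>i\<in>Poly_Mapping.keys n. \<sigma> i ^ Poly_Mapping.lookup n i)"
proof -
  let ?S = "Poly_Mapping.keys m \<union> Poly_Mapping.keys n"
  have *: "(\<Prod>i\<in>Poly_Mapping.keys k. \<sigma> i ^ Poly_Mapping.lookup k i) =
           (\<Prod>i\<in>?S. \<sigma> i ^ Poly_Mapping.lookup k i)"
    if "Poly_Mapping.keys k \<subseteq> ?S" for k
    by (rule prod.mono_neutral_left) (use that in \<open>auto simp: in_keys_iff\<close>)
  show ?thesis
    by (subst (1 2 3) *) (auto simp: lookup_add power_add prod.distrib Poly_Mapping.keys_add
        dest: subsetD[OF Poly_Mapping.keys_add])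
qed

lemma poly_value_mult: "poly_value h \<sigma> (p * q) = poly_value h \<sigma> p * poly_value h \<sigma> q"
proof (induction p rule: cpoly_induct)
  case (single m c)
  show ?case
    by (induction q rule: cpoly_induct)
      (simp_all add: mult_single poly_value_single poly_value_add monomial_value_add h_mult
        distrib_left)
next
  case (add p1 p2)
  then show ?case by (simp add: poly_value_add distrib_right)
qed

lemma has_value_unique:
  assumes "has_value h \<sigma> f v" "has_value h \<sigma> f w"
  shows "v = w"
proof -
  obtain p q where f: "f = Fract p q" and q: "poly_value h \<sigma> q \<noteq> 0"
    and v: "v = poly_value h \<sigma> p / poly_value h \<sigma> q"
    using assms(1) unfolding has_value_def by blast
  obtain p' q' where f': "f = Fract p' q'" and q': "poly_value h \<sigma> q' \<noteq> 0"
    and w: "w = poly_value h \<sigma> p' / poly_value h \<sigma> q'"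
    using assms(2) unfolding has_value_def by blast
  have "poly_value h \<sigma> (0::cpoly) = 0" by (simp add: poly_value_def)
  with q q' have "q \<noteq> 0" "q' \<noteq> 0" by auto
  then have "p * q' = p' * q" using f f' by (simp add: eq_fract)
  then have "poly_value h \<sigma> p * poly_value h \<sigma> q' = poly_value h \<sigma> p' * poly_value h \<sigma> q"
    by (metis poly_value_mult)
  then show ?thesis using q q' v w by (simp add: frac_eq_eq)
qed

lemma has_value_const: "has_value h \<sigma> (const c) (h c)"
  unfolding has_value_def const_def
  by (intro exI conjI, rule refl)
    (simp_all add: poly_value_single h_one flip: single_one)

lemma has_value_var: "has_value h \<sigma> (var i) (\<sigma> i)"
  unfolding has_value_def var_def
  by (intro exI conjI, rule refl)
    (simp_all add: poly_value_single h_one flip: single_one)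

lemma has_value_add:
  assumes "has_value h \<sigma> f v" "has_value h \<sigma> g w"
  shows "has_value h \<sigma> (f + g) (v + w)"
proof -
  obtain p q where f: "f = Fract p q" and q: "poly_value h \<sigma> q \<noteq> 0"
    and v: "v = poly_value h \<sigma> p / poly_value h \<sigma> q"
    using assms(1) unfolding has_value_def by blast
  obtain r s where g: "g = Fract r s" and s: "poly_value h \<sigma> s \<noteq> 0"
    and w: "w = poly_value h \<sigma> r / poly_value h \<sigma> s"
    using assms(2) unfolding has_value_def by blast
  have "q \<noteq> 0" "s \<noteq> 0" using q s by (auto simp: poly_value_def)
  then have "f + g = Fract (p * s + r * q) (q * s)" using f g by simp
  then show ?thesis
    unfolding has_value_def using q s v w
    by (intro exI[of _ "p * s + r * q"] exI[of _ "q * s"])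
      (simp add: poly_value_add poly_value_mult add_frac_eq)
qed

lemma has_value_mult:
  assumes "has_value h \<sigma> f v" "has_value h \<sigma> g w"
  shows "has_value h \<sigma> (f * g) (v * w)"
proof -
  obtain p q where f: "f = Fract p q" and q: "poly_value h \<sigma> q \<noteq> 0"
    and v: "v = poly_value h \<sigma> p / poly_value h \<sigma> q"
    using assms(1) unfolding has_value_def by blast
  obtain r s where g: "g = Fract r s" and s: "poly_value h \<sigma> s \<noteq> 0"
    and w: "w = poly_value h \<sigma> r / poly_value h \<sigma> s"
    using assms(2) unfolding has_value_def by blast
  show ?thesis
    unfolding has_value_def using f g q s v w
    by (intro exI[of _ "p * r"] exI[of _ "q * s"]) (simp add: poly_value_mult)
qed

lemma has_value_minus:
  assumes "has_value h \<sigma> f v"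
  shows "has_value h \<sigma> (- f) (- v)"
proof -
  have "- f = const (- 1) * f"
    by (simp add: const_def single_uminus One_fract_def flip: minus_fract)
  moreover have "- v = h (- 1) * v" by (simp add: h_minus h_one)
  ultimately show ?thesis by (metis has_value_mult has_value_const assms)
qed

lemma has_value_diff:
  "has_value h \<sigma> f v \<Longrightarrow> has_value h \<sigma> g w \<Longrightarrow> has_value h \<sigma> (f - g) (v - w)"
  using has_value_add[of \<sigma> f v "- g" "- w"] has_value_minus[of \<sigma> g w] by simp

lemma nonzero_if_has_value:
  assumes "has_value h \<sigma> f v" "v \<noteq> 0"
  shows "f \<noteq> 0"
proof -
  have "has_value h \<sigma> 0 0"
    using has_value_const[of \<sigma> 0] by (simp add: const_def h_zero Zero_fract_def)
  then show ?thesis using assms has_value_unique by blast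
qed

end

interpretation id_embedding: embedding "id :: complex \<Rightarrow> complex"
  by unfold_locales auto

interpretation const_embedding: embedding const
  by unfold_locales (simp_all add: const_def single_add mult_single One_fract_def)


subsection \<open>The denominators are nonzero rational functions\<close>

lemmas has_value_intros = id_embedding.has_value_const id_embedding.has_value_var
  id_embedding.has_value_add id_embedding.has_value_mult id_embedding.has_value_diff

lemma T9_denominators:
  defines "x1 \<equiv> var 0" and "x2 \<equiv> var 1" and "X \<equiv> var 2"
    and "y1 \<equiv> var 3" and "y2 \<equiv> var 4" and "Y \<equiv> var 5"
    and "z1 \<equiv> var 6" and "z2 \<equiv> var 7" and "Z \<equiv> var 8"
  shows "z1 * z2 - Z \<noteq> 0" "x1 * x2 - X \<noteq> 0"
    "y1 * y2 * z1 * (x1 * y2 + z2) * X - (x1 * y2 * z1 + z1 * z2 - Z) * X * Y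
       + x2 * (y1 * z2 + x1 * (y1 * y2 - Y)) * Z \<noteq> 0"
  unfolding assms
  by (rule id_embedding.nonzero_if_has_value[where \<sigma> = "\<lambda>i. if i \<in> {2, 5, 8} then 1 else 0"],
      (rule has_value_intros)+, simp)+

lemma T6_denominators:
  assumes "a \<noteq> 0" "b \<noteq> 0" "c \<noteq> 0"
  defines "x1 \<equiv> var 0" and "x2 \<equiv> var 1" and "y1 \<equiv> var 2"
    and "y2 \<equiv> var 3" and "z1 \<equiv> var 4" and "z2 \<equiv> var 5"
  shows "const c \<noteq> 0" "const a * const c \<noteq> 0"
    "const a * const b * const c - (x2 * z2 + y2 * (const a + x1 * x2)) *
       (const b * x1 * z1 - y1 * (const c + z1 * z2)) \<noteq> 0"
  unfolding assms(4-)
  by (rule id_embedding.nonzero_if_has_value[where \<sigma> = "\<lambda>i. 0"],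
      (rule has_value_intros)+, simp add: assms(1-3))+

end

theory Submission
  imports Defs
begin

text \<open>
  The map on the leaves solves the local Yang-Baxter equation
  \<open>A\<^sub>2\<^sub>3(z) A\<^sub>1\<^sub>3(y) A\<^sub>1\<^sub>2(x) = A\<^sub>1\<^sub>2(u) A\<^sub>1\<^sub>3(v) A\<^sub>2\<^sub>3(w)\<close>, where \<open>A\<^sub>i\<^sub>j\<close> is the 2 by 2 Lax matrix
  with rows \<open>(X, x1)\<close> and \<open>(x2, 1)\<close> placed in rows and columns \<open>i, j\<close>, and \<open>X - x1 x2\<close> is its
  determinant. Both sides of the tetrahedron equation rewrite the 4 by 4 matrix
  \<open>A\<^sub>3\<^sub>4 A\<^sub>2\<^sub>4 A\<^sub>1\<^sub>4 A\<^sub>2\<^sub>3 A\<^sub>1\<^sub>3 A\<^sub>1\<^sub>2\<close> as a product \<open>A\<^sub>1\<^sub>2 A\<^sub>1\<^sub>3 A\<^sub>2\<^sub>3 A\<^sub>1\<^sub>4 A\<^sub>2\<^sub>4 A\<^sub>3\<^sub>4\<close> with the same determinants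
  of the factors, and such a factorization is unique.
\<close>


subsection \<open>Values of rational functions\<close>

text \<open>Uniqueness of values eliminates the definite description. The proofs below work with the
  relation \<open>has_value\<close>, which is compatible with the field operations.\<close>

lemma (in embedding) rat_value_eq_Some_iff: "rat_value h \<sigma> f = Some v \<longleftrightarrow> has_value h \<sigma> f v"
proof
  assume v: "has_value h \<sigma> f v"
  then have "(THE v. has_value h \<sigma> f v) = v"
    using has_value_unique by blast
  then show "rat_value h \<sigma> f = Some v"
    using v unfolding rat_value_def by auto
next
  assume "rat_value h \<sigma> f = Some v"
  then obtain w where w: "has_value h \<sigma> f w" and "v = (THE v. has_value h \<sigma> f v)"
    unfolding rat_value_def by (auto split: if_splits)
  moreover have "(THE v. has_value h \<sigma> f v) = w"
    using w has_value_unique by blast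
  ultimately show "has_value h \<sigma> f v" by simp
qed

lemma (in embedding) has_value_divide:
  assumes "has_value h \<sigma> f v" "has_value h \<sigma> g w" "w \<noteq> 0"
  shows "has_value h \<sigma> (f / g) (v / w)"
proof -
  obtain p q where f: "f = Fract p q" and q: "poly_value h \<sigma> q \<noteq> 0"
    and v: "v = poly_value h \<sigma> p / poly_value h \<sigma> q"
    using assms(1) unfolding has_value_def by blast
  obtain r s where g: "g = Fract r s" and s: "poly_value h \<sigma> s \<noteq> 0"
    and w: "w = poly_value h \<sigma> r / poly_value h \<sigma> s"
    using assms(2) unfolding has_value_def by blast
  have r: "poly_value h \<sigma> r \<noteq> 0"
    using w assms(3) by auto
  have "f / g = Fract (p * s) (q * r)"
    using f g by simp
  then show ?thesis
    unfolding has_value_def using q r s v w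
    by (intro exI[of _ "p * s"] exI[of _ "q * r"]) (simp add: poly_value_mult)
qed

lemma (in embedding) h_nonzero: "x \<noteq> 0 \<Longrightarrow> h x \<noteq> 0"
  by (metis h_mult h_one mult_zero_left right_inverse zero_neq_one)

text \<open>Follows from \<open>f / g * g = f\<close> in the field of rational functions. As
  \<open>y = 0\<close> is allowed, a regular quotient whose denominator vanishes at a point has a
  numerator vanishing there too.\<close>

lemma (in embedding) has_value_divide_unique:
  assumes "has_value h \<sigma> (f / g) v" "has_value h \<sigma> f x" "has_value h \<sigma> g y" "g \<noteq> 0"
  shows "v * y = x"
  using has_value_mult[OF assms(1,3)] assms(2,4) has_value_unique by fastforce

lemma those_eq_Some_iff: "those xs = Some ys \<longleftrightarrow> map Some ys = xs"
  by (induction xs arbitrary: ys) (auto split: option.splits simp: map_eq_Cons_conv)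

lemma map_at_eq_Some_iff: "map_at F p = Some q \<longleftrightarrow> list_all2 (has_value id ((!) p)) F q"
  unfolding map_at_def those_eq_Some_iff
  by (auto simp: list_eq_iff_nth_eq list_all2_conv_all_nth
      simp flip: id_embedding.rat_value_eq_Some_iff)

lemma comp_map_eq_Some_iff: "comp_map F G = Some H \<longleftrightarrow> list_all2 (has_value const ((!) G)) F H"
  unfolding comp_map_def those_eq_Some_iff
  by (auto simp: list_eq_iff_nth_eq list_all2_conv_all_nth
      simp flip: const_embedding.rat_value_eq_Some_iff)

section \<open>Limits of values along curves\<close>

lemma tendsto_poly_value_id:
  assumes "\<And>i. ((\<lambda>t. \<gamma> t i) \<longlongrightarrow> \<sigma> i) F"
  shows "((\<lambda>t. poly_value id (\<gamma> t) p) \<longlongrightarrow> poly_value id \<sigma> p) F"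
  unfolding poly_value_def by (intro tendsto_intros assms)

text \<open>A representation whose denominator is nonzero at \<open>\<sigma>\<close> keeps a nonzero
  denominator nearby on the curve, so one quotient of polynomials gives all these values.\<close>

lemma has_value_along_curve:
  assumes "has_value id \<sigma> f v" "\<And>i. ((\<lambda>t. \<gamma> t i) \<longlongrightarrow> \<sigma> i) F"
  obtains \<phi> where "(\<phi> \<longlongrightarrow> v) F" "\<forall>\<^sub>F t in F. has_value id (\<gamma> t) f (\<phi> t)"
proof -
  obtain p q where f: "f = Fract p q" and q: "poly_value id \<sigma> q \<noteq> 0"
    and v: "v = poly_value id \<sigma> p / poly_value id \<sigma> q"
    using assms(1) unfolding has_value_def by blast
  note lim = tendsto_poly_value_id[of \<gamma> \<sigma> F, OF assms(2)]
  show ?thesis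
  proof
    show "((\<lambda>t. poly_value id (\<gamma> t) p / poly_value id (\<gamma> t) q) \<longlongrightarrow> v) F"
      unfolding v by (intro tendsto_divide lim q)
    have "\<forall>\<^sub>F t in F. poly_value id (\<gamma> t) q \<noteq> 0"
      using lim q by (rule tendsto_imp_eventually_ne)
    then show "\<forall>\<^sub>F t in F. has_value id (\<gamma> t) f
        (poly_value id (\<gamma> t) p / poly_value id (\<gamma> t) q)"
      by eventually_elim (use f in \<open>auto simp: has_value_def\<close>)
  qed
qed

text \<open>Cancel \<open>t ^ k\<close> for \<open>t \<noteq> 0\<close> and let \<open>t\<close>
  tend to 0, as in l'Hopital's rule. This extracts information at points where numerator and
  denominator both vanish.\<close>

lemma has_value_divide_along_curve:
  fixes \<gamma> :: "complex \<Rightarrow> nat \<Rightarrow> complex"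
  assumes f: "has_value id \<sigma> (f / g) v" and g: "g \<noteq> 0"
    and \<gamma>: "\<And>i. ((\<lambda>t. \<gamma> t i) \<longlongrightarrow> \<sigma> i) (at 0)"
    and x: "\<And>t. has_value id (\<gamma> t) f (t ^ k * x t)"
    and y: "\<And>t. has_value id (\<gamma> t) g (t ^ k * y t)"
    and cont: "isCont x 0" "isCont y 0"
  shows "v * y 0 = x 0"
proof -
  obtain \<phi> where \<phi>: "(\<phi> \<longlongrightarrow> v) (at 0)"
    and ev: "\<forall>\<^sub>F t in at 0. has_value id (\<gamma> t) (f / g) (\<phi> t)"
    using has_value_along_curve[of \<sigma> "f / g" v \<gamma> "at 0", OF f \<gamma>] by blast
  have "\<forall>\<^sub>F t in at 0. t \<noteq> (0::complex)"
    by (simp add: eventually_at_filter)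
  with ev have "\<forall>\<^sub>F t in at 0. \<phi> t * y t = x t"
  proof eventually_elim
    case (elim t)
    have "\<phi> t * (t ^ k * y t) = t ^ k * x t"
      by (rule id_embedding.has_value_divide_unique[OF elim(1) x y g])
    then show ?case using elim(2) by auto
  qed
  moreover have "((\<lambda>t. \<phi> t * y t) \<longlongrightarrow> v * y 0) (at 0)"
    using \<phi> cont(2) by (intro tendsto_mult) (auto simp: isCont_def)
  ultimately have "(x \<longlongrightarrow> v * y 0) (at 0)"
    using tendsto_cong by force
  moreover have "(x \<longlongrightarrow> x 0) (at 0)"
    using cont(1) by (simp add: isCont_def)
  ultimately show ?thesis
    by (rule tendsto_unique[rotated]) simp
qed

section \<open>Rational functions of the first \<open>n\<close> variables\<close>

definition poly_in :: "nat \<Rightarrow> cpoly \<Rightarrow> bool" where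
  "poly_in n p \<longleftrightarrow> (\<forall>k\<in>Poly_Mapping.keys p. Poly_Mapping.keys k \<subseteq> {..<n})"

lemma poly_in_add: "poly_in n p \<Longrightarrow> poly_in n q \<Longrightarrow> poly_in n (p + q)"
  unfolding poly_in_def using Poly_Mapping.keys_add[of p q] by blast

lemma poly_in_uminus: "poly_in n p \<Longrightarrow> poly_in n (- p)"
  by (simp add: poly_in_def)

lemma poly_in_mult:
  assumes "poly_in n p" "poly_in n q"
  shows "poly_in n (p * q)"
  unfolding poly_in_def
proof
  fix k assume "k \<in> Poly_Mapping.keys (p * q)"
  then obtain l m where "k = l + m" "l \<in> Poly_Mapping.keys p" "m \<in> Poly_Mapping.keys q"
    using keys_mult[of p q] by blast
  then show "Poly_Mapping.keys k \<subseteq> {..<n}"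
    using Poly_Mapping.keys_add[of l m] assms unfolding poly_in_def by blast
qed

text \<open>The condition that \<open>is_ratmap\<close> imposes on each component, isolated because
  the field operations preserve it.\<close>

definition rat_in :: "nat \<Rightarrow> ratfun \<Rightarrow> bool" where
  "rat_in n f \<longleftrightarrow> (\<exists>p q. f = Fract p q \<and> q \<noteq> 0 \<and> poly_in n p \<and> poly_in n q)"

lemma rat_in_const: "rat_in n (const c)"
  unfolding rat_in_def const_def
  by (intro exI conjI, rule refl) (auto simp: poly_in_def)

lemma rat_in_var: "i < n \<Longrightarrow> rat_in n (var i)"
  unfolding rat_in_def var_def
  by (intro exI conjI, rule refl) (auto simp: poly_in_def)

lemma rat_in_add:
  assumes "rat_in n f" "rat_in n g"
  shows "rat_in n (f + g)"
proof -
  obtain p q r s where "f = Fract p q" "q \<noteq> 0" "poly_in n p" "poly_in n q"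
      "g = Fract r s" "s \<noteq> 0" "poly_in n r" "poly_in n s"
    using assms unfolding rat_in_def by blast
  then show ?thesis
    unfolding rat_in_def
    by (intro exI[of _ "p * s + r * q"] exI[of _ "q * s"])
      (simp add: poly_in_add poly_in_mult)
qed

lemma rat_in_diff:
  assumes "rat_in n f" "rat_in n g"
  shows "rat_in n (f - g)"
proof -
  obtain p q where g: "g = Fract p q" "q \<noteq> 0" "poly_in n p" "poly_in n q"
    using assms(2) unfolding rat_in_def by blast
  then have "rat_in n (- g)"
    unfolding rat_in_def by (intro exI[of _ "- p"] exI[of _ q]) (simp add: poly_in_uminus)
  then show ?thesis using rat_in_add[OF assms(1)] by fastforce
qed

lemma rat_in_mult:
  assumes "rat_in n f" "rat_in n g"
  shows "rat_in n (f * g)"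
proof -
  obtain p q r s where "f = Fract p q" "q \<noteq> 0" "poly_in n p" "poly_in n q"
      "g = Fract r s" "s \<noteq> 0" "poly_in n r" "poly_in n s"
    using assms unfolding rat_in_def by blast
  then show ?thesis
    unfolding rat_in_def
    by (intro exI[of _ "p * r"] exI[of _ "q * s"]) (simp add: poly_in_mult)
qed

lemma rat_in_divide:
  assumes "rat_in n f" "rat_in n g"
  shows "rat_in n (f / g)"
proof (cases "g = 0")
  case True
  \<comment> \<open>A quotient by 0 is 0 by convention, and 0 is obtained as
    \<open>f - f\<close>.\<close>
  then show ?thesis using rat_in_diff[OF assms(1,1)] by simp
next
  case False
  obtain p q r s where *: "f = Fract p q" "q \<noteq> 0" "poly_in n p" "poly_in n q"
      "g = Fract r s" "s \<noteq> 0" "poly_in n r" "poly_in n s"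
    using assms unfolding rat_in_def by blast
  moreover have "r \<noteq> 0" using False * by (auto simp: fract_collapse)
  ultimately show ?thesis
    unfolding rat_in_def
    by (intro exI[of _ "p * s"] exI[of _ "q * r"]) (simp add: poly_in_mult)
qed

lemmas rat_in_intros = rat_in_const rat_in_var rat_in_add rat_in_diff rat_in_mult rat_in_divide

lemma is_ratmap_iff: "is_ratmap n m F \<longleftrightarrow> length F = m \<and> (\<forall>f\<in>set F. rat_in n f)"
  unfolding is_ratmap_def rat_in_def poly_in_def by (simp add: ball_Un)

lemma is_ratmap_T6: "is_ratmap 6 6 (T6 a b c)"
  unfolding is_ratmap_iff T6_def Let_def by (auto intro!: rat_in_intros)


subsection \<open>The local Yang-Baxter equation\<close>

text \<open>
  The Lax matrix with rows \<open>(d + s t, s)\<close> and \<open>(t, 1)\<close>, of determinant \<open>d\<close>, acting on the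
  coordinates \<open>i\<close> and \<open>j\<close> of a vector.
\<close>

definition rot :: "nat \<Rightarrow> nat \<Rightarrow> 'k::field \<Rightarrow> 'k \<Rightarrow> 'k \<Rightarrow> (nat \<Rightarrow> 'k) \<Rightarrow> nat \<Rightarrow> 'k" where
  "rot i j d s t v = v(i := (d + s * t) * v i + s * v j, j := t * v i + v j)"

definition t6_den :: "'k::field \<Rightarrow> 'k \<Rightarrow> 'k \<Rightarrow> 'k \<Rightarrow> 'k \<Rightarrow> 'k \<Rightarrow> 'k \<Rightarrow> 'k \<Rightarrow> 'k \<Rightarrow> 'k" where
  "t6_den a b c x1 x2 y1 y2 z1 z2 =
     a * b * c - (x2 * z2 + y2 * (a + x1 * x2)) * (b * x1 * z1 - y1 * (c + z1 * z2))"

text \<open>Formulated over an arbitrary field, so that coordinates and parameters may be complex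
  numbers or rational functions. Nonconstant parameters serve for the nine-dimensional map.\<close>

definition t6 :: "'k::field \<Rightarrow> 'k \<Rightarrow> 'k \<Rightarrow> 'k \<Rightarrow> 'k \<Rightarrow> 'k \<Rightarrow> 'k \<Rightarrow> 'k \<Rightarrow> 'k \<Rightarrow> 'k list" where
  "t6 a b c x1 x2 y1 y2 z1 z2 =
     [(b * x1 - y1 * z2) / c,
      a * c * (x2 * (c + z1 * z2) + y2 * z1 * (a + x1 * x2)) / t6_den a b c x1 x2 y1 y2 z1 z2,
      (y1 * (c + z1 * z2) - b * x1 * z1) / (a * c),
      x2 * z2 + y2 * (a + x1 * x2),
      c * (b * z1 * (a + x1 * x2) - x2 * y1 * (c + z1 * z2)) / t6_den a b c x1 x2 y1 y2 z1 z2,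
      x1 * y2 + z2]"

text \<open>Comparison of the 3 by 3 matrices in the local Yang-Baxter equation, entry by entry. The
  ninth entry, in the last row and column, is 1 on both sides.\<close>

lemma t6_equations:
  fixes a b c :: "'k::field"
  assumes nz: "a \<noteq> 0" "c \<noteq> 0" "t6_den a b c x1 x2 y1 y2 z1 z2 \<noteq> 0"
    and t6: "t6 a b c x1 x2 y1 y2 z1 z2 = [u1, u2, v1, v2, w1, w2]"
  shows "(a + u1 * u2) * (b + v1 * v2) = (a + x1 * x2) * (b + y1 * y2)"
    and "u2 * (b + v1 * v2) = z1 * y2 * (a + x1 * x2) + (c + z1 * z2) * x2"
    and "w1 + u2 * v1 = z1"
    and "u1 * w1 + (a + u1 * u2) * v1 = y1"
    and "u1 * (c + w1 * w2) + (a + u1 * u2) * v1 * w2 = x1 * (b + y1 * y2)"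
    and "c + w1 * w2 + u2 * v1 * w2 = z1 * y2 * x1 + c + z1 * z2"
    and "v2 = y2 * (a + x1 * x2) + z2 * x2"
    and "w2 = y2 * x1 + z2"
proof -
  define D where "D = t6_den a b c x1 x2 y1 y2 z1 z2"
  have D: "D \<noteq> 0" using nz(3) by (simp add: D_def)
  have D': "D = a * b * c - (x2 * z2 + y2 * (a + x1 * x2)) * (b * x1 * z1 - y1 * (c + z1 * z2))"
    by (simp add: D_def t6_den_def)
  have eqs: "u1 = (b * x1 - y1 * z2) / c"
      "u2 = a * c * (x2 * (c + z1 * z2) + y2 * z1 * (a + x1 * x2)) / D"
      "v1 = (y1 * (c + z1 * z2) - b * x1 * z1) / (a * c)"
      "v2 = x2 * z2 + y2 * (a + x1 * x2)"
      "w1 = c * (b * z1 * (a + x1 * x2) - x2 * y1 * (c + z1 * z2)) / D"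
      "w2 = x1 * y2 + z2"
    using t6 by (auto simp: t6_def D_def)
  \<comment> \<open>The denominator \<open>D\<close> is \<open>a * c\<close> times the upper left
    entry of the second new Lax matrix, so multiplying \<open>u2\<close> by this entry clears
    \<open>D\<close>.\<close>
  have V: "b + v1 * v2 = D / (a * c)"
    unfolding eqs D' using nz(1,2) by (simp add: field_simps)
  show 2: "u2 * (b + v1 * v2) = z1 * y2 * (a + x1 * x2) + (c + z1 * z2) * x2"
    unfolding V eqs(2) using nz(1,2) D by (simp add: field_simps)
  have U: "(a + u1 * u2) * D = a * c * (a + x1 * x2) * (b + y1 * y2)"
  proof -
    have "(a + u1 * u2) * D = a * D + (b * x1 - y1 * z2) / c * (u2 * D)"
      by (simp add: eqs(1) algebra_simps)
    also have "u2 * D = a * c * (x2 * (c + z1 * z2) + y2 * z1 * (a + x1 * x2))"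
      using D by (simp add: eqs(2))
    also have "a * D + (b * x1 - y1 * z2) / c * (a * c * (x2 * (c + z1 * z2) + y2 * z1 * (a + x1 * x2)))
        = a * c * (a + x1 * x2) * (b + y1 * y2)"
      using nz(2) unfolding D' by (simp add: field_simps)
    finally show ?thesis .
  qed
  have U': "a + u1 * u2 = a * c * (a + x1 * x2) * (b + y1 * y2) / D"
    using U D by (simp add: field_simps)
  show "(a + u1 * u2) * (b + v1 * v2) = (a + x1 * x2) * (b + y1 * y2)"
    unfolding V U' using nz(1,2) D by (simp add: field_simps)
  show 3: "w1 + u2 * v1 = z1"
  proof -
    have "w1 * D = c * (b * z1 * (a + x1 * x2) - x2 * y1 * (c + z1 * z2))"
      using D by (simp add: eqs(5))
    moreover have "u2 * D = a * c * (x2 * (c + z1 * z2) + y2 * z1 * (a + x1 * x2))"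
      using D by (simp add: eqs(2))
    moreover have "v1 * (a * c) = y1 * (c + z1 * z2) - b * x1 * z1"
      using nz(1,2) by (simp add: eqs(3))
    ultimately have "(w1 + u2 * v1) * D = z1 * D"
      unfolding D' by algebra
    then show ?thesis using D by simp
  qed
  show 4: "u1 * w1 + (a + u1 * u2) * v1 = y1"
  proof -
    have "u1 * w1 + (a + u1 * u2) * v1 = u1 * (w1 + u2 * v1) + a * v1"
      by (simp add: algebra_simps)
    also have "\<dots> = y1"
      unfolding 3 unfolding eqs(1,3) using nz(1,2) by (simp add: field_simps)
    finally show ?thesis .
  qed
  \<comment> \<open>In the last two entries \<open>w2\<close> is multiplied by an entry of the third
    column, already known to be \<open>y1\<close> or \<open>z1\<close>.\<close>
  have "u1 * (c + w1 * w2) + (a + u1 * u2) * v1 * w2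
      = u1 * c + (u1 * w1 + (a + u1 * u2) * v1) * w2"
    by (simp add: algebra_simps)
  also have "\<dots> = x1 * (b + y1 * y2)"
    unfolding 4 unfolding eqs(1,6) using nz(2) by (simp add: field_simps)
  finally show "u1 * (c + w1 * w2) + (a + u1 * u2) * v1 * w2 = x1 * (b + y1 * y2)" .
  have "c + w1 * w2 + u2 * v1 * w2 = c + (w1 + u2 * v1) * w2"
    by (simp add: algebra_simps)
  also have "\<dots> = z1 * y2 * x1 + c + z1 * z2"
    unfolding 3 unfolding eqs(6) by (simp add: algebra_simps)
  finally show "c + w1 * w2 + u2 * v1 * w2 = z1 * y2 * x1 + c + z1 * z2" .
qed (use t6 in \<open>auto simp: t6_def\<close>)

text \<open>All triples of distinct indices are included because the tetrahedron equation uses the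
  four triples from \<open>{0, 1, 2, 3}\<close>.\<close>

definition local_Yang_Baxter where
  "local_Yang_Baxter a b c x1 x2 y1 y2 z1 z2 u1 u2 v1 v2 w1 w2 \<longleftrightarrow>
     (\<forall>i j k v. i \<noteq> j \<and> i \<noteq> k \<and> j \<noteq> k \<longrightarrow>
        rot j k c z1 z2 (rot i k b y1 y2 (rot i j a x1 x2 v))
      = rot i j a u1 u2 (rot i k b v1 v2 (rot j k c w1 w2 v)))"

lemma local_Yang_BaxterD:
  assumes "local_Yang_Baxter a b c x1 x2 y1 y2 z1 z2 u1 u2 v1 v2 w1 w2"
    and "i \<noteq> j" "i \<noteq> k" "j \<noteq> k"
  shows "rot j k c z1 z2 (rot i k b y1 y2 (rot i j a x1 x2 v))
       = rot i j a u1 u2 (rot i k b v1 v2 (rot j k c w1 w2 v))"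
  using assms unfolding local_Yang_Baxter_def by blast

lemma t6_local_Yang_Baxter:
  fixes a b c :: "'k::field"
  assumes nz: "a \<noteq> 0" "c \<noteq> 0" "t6_den a b c x1 x2 y1 y2 z1 z2 \<noteq> 0"
    and t6: "t6 a b c x1 x2 y1 y2 z1 z2 = [u1, u2, v1, v2, w1, w2]"
  shows "local_Yang_Baxter a b c x1 x2 y1 y2 z1 z2 u1 u2 v1 v2 w1 w2"
  unfolding local_Yang_Baxter_def
proof (intro allI impI ext)
  note eq = t6_equations[OF nz t6]
  fix i j k n :: nat and v
  assume distinct: "i \<noteq> j \<and> i \<noteq> k \<and> j \<noteq> k"
  let ?L = "rot j k c z1 z2 (rot i k b y1 y2 (rot i j a x1 x2 v))"
    and ?R = "rot i j a u1 u2 (rot i k b v1 v2 (rot j k c w1 w2 v))"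
  have i: "?L i = ?R i"
  proof -
    have "?L i = (a + x1 * x2) * (b + y1 * y2) * v i + x1 * (b + y1 * y2) * v j + y1 * v k"
      using distinct by (simp add: rot_def algebra_simps)
    also have "\<dots> = ((a + u1 * u2) * (b + v1 * v2)) * v i
        + (u1 * (c + w1 * w2) + (a + u1 * u2) * v1 * w2) * v j + (u1 * w1 + (a + u1 * u2) * v1) * v k"
      unfolding eq(1,4,5) ..
    also have "\<dots> = ?R i"
      using distinct by (simp add: rot_def algebra_simps)
    finally show ?thesis .
  qed
  have j: "?L j = ?R j"
  proof -
    have "?L j = (z1 * y2 * (a + x1 * x2) + (c + z1 * z2) * x2) * v i
        + (z1 * y2 * x1 + c + z1 * z2) * v j + z1 * v k"
      using distinct by (simp add: rot_def algebra_simps)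
    also have "\<dots> = (u2 * (b + v1 * v2)) * v i + (c + w1 * w2 + u2 * v1 * w2) * v j + (w1 + u2 * v1) * v k"
      unfolding eq(2,3,6) ..
    also have "\<dots> = ?R j"
      using distinct by (simp add: rot_def algebra_simps)
    finally show ?thesis .
  qed
  have k: "?L k = ?R k"
    using distinct unfolding eq(7,8) by (simp add: rot_def algebra_simps)
  show "?L n = ?R n"
    using i j k distinct by (cases "n = i \<or> n = j \<or> n = k") (auto simp: rot_def)
qed

section \<open>Uniqueness of the factorization of the 4 by 4 matrix\<close>

lemma rot_commute:
  assumes "{i, j} \<inter> {k, l} = {}"
  shows "rot i j d s t (rot k l d' s' t' v) = rot k l d' s' t' (rot i j d s t v)"
  using assms by (auto simp: rot_def fun_eq_iff)

text \<open>
  Reading the factors off the product: its last row gives \<open>m2, n2, o2\<close>. Below, \<open>p\<close> is the product of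
  the first three factors; the product determines the last column of \<open>p\<close> and the 2-minors of its last
  two columns, hence \<open>x1, y1\<close> and (by Cramer's rule) \<open>m1\<close>. Then the first column of \<open>p\<close> is
  known, and the other entries follow one by one.
\<close>

lemma rot_factorization_unique:
  fixes a b c d e f :: "'k::field"
  assumes nz: "a \<noteq> 0" "b \<noteq> 0" "c \<noteq> 0" "e \<noteq> 0" "f \<noteq> 0"
    and nz': "b + y1 * y2 \<noteq> 0" "d + m1 * m2 \<noteq> 0" "e + n1 * n2 \<noteq> 0"
    and eq: "\<And>v. rot 0 1 a x1 x2 (rot 0 2 b y1 y2 (rot 1 2 c z1 z2
           (rot 0 3 d m1 m2 (rot 1 3 e n1 n2 (rot 2 3 f o1 o2 v)))))
      = rot 0 1 a x1' x2' (rot 0 2 b y1' y2' (rot 1 2 c z1' z2'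
           (rot 0 3 d m1' m2' (rot 1 3 e n1' n2' (rot 2 3 f o1' o2' v)))))"
  shows "[x1, x2, y1, y2, z1, z2, m1, m2, n1, n2, o1, o2]
       = [x1', x2', y1', y2', z1', z2', m1', m2', n1', n2', o1', o2']"
proof -
  define P where "P x1 x2 y1 y2 z1 z2 = (\<lambda>v. rot 0 1 a x1 x2 (rot 0 2 b y1 y2 (rot 1 2 c z1 z2 v)))"
    for x1 x2 y1 y2 z1 z2
  define p where "p = P x1 x2 y1 y2 z1 z2"
  define p' where "p' = P x1' x2' y1' y2' z1' z2'"
  \<comment> \<open>Basis vectors: \<open>p (E j) i\<close> is the entry of \<open>p\<close> in row
    \<open>i\<close> and column \<open>j\<close>.\<close>
  define E where "E = (\<lambda>(j::nat) (i::nat). if i = j then 1 else 0 :: 'k)"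
  have pE: "p (E 0) 0 = (a + x1 * x2) * (b + y1 * y2)" "p (E 0) 1 = x2 * (b + y1 * y2)" "p (E 0) 2 = y2"
    "p (E 1) 0 = x1 * (c + z1 * z2) + (a + x1 * x2) * y1 * z2"
    "p (E 1) 1 = c + z1 * z2 + x2 * y1 * z2" "p (E 1) 2 = z2"
    "p (E 2) 0 = x1 * z1 + (a + x1 * x2) * y1" "p (E 2) 1 = z1 + x2 * y1" "p (E 2) 2 = 1"
    by (simp_all add: p_def P_def E_def rot_def algebra_simps)
  have pE': "p' (E 0) 0 = (a + x1' * x2') * (b + y1' * y2')" "p' (E 0) 1 = x2' * (b + y1' * y2')" "p' (E 0) 2 = y2'"
    "p' (E 1) 0 = x1' * (c + z1' * z2') + (a + x1' * x2') * y1' * z2'"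
    "p' (E 1) 1 = c + z1' * z2' + x2' * y1' * z2'" "p' (E 1) 2 = z2'"
    "p' (E 2) 0 = x1' * z1' + (a + x1' * x2') * y1'" "p' (E 2) 1 = z1' + x2' * y1'" "p' (E 2) 2 = 1"
    by (simp_all add: p'_def P_def E_def rot_def algebra_simps)
  have last: "m2 = m2'" "n2 = n2'" "o2 = o2'"
    using fun_cong[OF eq[of "E 0"], of 3] fun_cong[OF eq[of "E 1"], of 3] fun_cong[OF eq[of "E 2"], of 3]
    by (simp_all add: rot_def E_def)
  have lin: "p v i = v 0 * p (E 0) i + v 1 * p (E 1) i + v 2 * p (E 2) i" if "i \<in> {0, 1, 2}" for v i
    using that by (auto simp: p_def P_def E_def rot_def algebra_simps)
  have lin': "p' v i = v 0 * p' (E 0) i + v 1 * p' (E 1) i + v 2 * p' (E 2) i" if "i \<in> {0, 1, 2}" for v i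
    using that by (auto simp: p'_def P_def E_def rot_def algebra_simps)
  define r where "r v = rot 0 3 d m1 m2 (rot 1 3 e n1 n2 (rot 2 3 f o1 o2 v))" for v
  define r' where "r' v = rot 0 3 d m1' m2' (rot 1 3 e n1' n2' (rot 2 3 f o1' o2' v))" for v
  have eq': "r v 0 * p (E 0) i + r v 1 * p (E 1) i + r v 2 * p (E 2) i
      = r' v 0 * p' (E 0) i + r' v 1 * p' (E 1) i + r' v 2 * p' (E 2) i" if "i \<in> {0, 1, 2}" for v i
    using fun_cong[OF eq[of v], of i] lin[OF that, of "r v"] lin'[OF that, of "r' v"]
    by (simp add: p_def p'_def P_def r_def r'_def)
  \<comment> \<open>\<open>Q0\<close> to \<open>Q3\<close> compare the four columns of the full
    products in the rows 0, 1, 2.\<close>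
  have Q0: "(d + m1 * m2) * p (E 0) i = (d + m1' * m2') * p' (E 0) i"
    and Q1: "m1 * n2 * p (E 0) i + (e + n1 * n2) * p (E 1) i
      = m1' * n2' * p' (E 0) i + (e + n1' * n2') * p' (E 1) i"
    and Q2: "m1 * o2 * p (E 0) i + n1 * o2 * p (E 1) i + (f + o1 * o2) * p (E 2) i
      = m1' * o2' * p' (E 0) i + n1' * o2' * p' (E 1) i + (f + o1' * o2') * p' (E 2) i"
    and Q3: "m1 * p (E 0) i + n1 * p (E 1) i + o1 * p (E 2) i
      = m1' * p' (E 0) i + n1' * p' (E 1) i + o1' * p' (E 2) i" if "i \<in> {0, 1, 2}" for i
  proof -
    show "(d + m1 * m2) * p (E 0) i = (d + m1' * m2') * p' (E 0) i"
      using eq'[OF that, of "E 0"] by (simp add: r_def r'_def rot_def E_def)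
    show "m1 * n2 * p (E 0) i + (e + n1 * n2) * p (E 1) i
      = m1' * n2' * p' (E 0) i + (e + n1' * n2') * p' (E 1) i"
      using eq'[OF that, of "E 1"] by (simp add: r_def r'_def rot_def E_def)
    show "m1 * o2 * p (E 0) i + n1 * o2 * p (E 1) i + (f + o1 * o2) * p (E 2) i
      = m1' * o2' * p' (E 0) i + n1' * o2' * p' (E 1) i + (f + o1' * o2') * p' (E 2) i"
      using eq'[OF that, of "E 2"] by (simp add: r_def r'_def rot_def E_def)
    show "m1 * p (E 0) i + n1 * p (E 1) i + o1 * p (E 2) i
      = m1' * p' (E 0) i + n1' * p' (E 1) i + o1' * p' (E 2) i"
      using eq'[OF that, of "E 3"] by (simp add: r_def r'_def rot_def E_def)
  qed
  have p2: "p (E 2) i = p' (E 2) i" if "i \<in> {0, 1, 2}" for i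
  proof -
    \<comment> \<open>Subtract \<open>o2\<close> times \<open>Q3\<close> from
      \<open>Q2\<close>.\<close>
    have "f * p (E 2) i = f * p' (E 2) i"
      using Q2[OF that] Q3[OF that] last by algebra
    then show ?thesis using nz(5) by simp
  qed
  \<comment> \<open>\<open>Q1\<close> minus \<open>n2\<close> times \<open>Q3\<close> gives
    \<open>e * p (E 1)\<close> up to a multiple of \<open>p (E 2)\<close>. The multiple involves the
    still undetermined \<open>o1\<close>, but drops out of the minors formed with
    \<open>p (E 2)\<close>.\<close>
  define w where "w i j = p (E 1) i * p (E 2) j - p (E 2) i * p (E 1) j" for i j
  define w' where "w' i j = p' (E 1) i * p' (E 2) j - p' (E 2) i * p' (E 1) j" for i j
  have w: "w i j = w' i j" if "i \<in> {0, 1, 2}" "j \<in> {0, 1, 2}" for i j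
  proof -
    have "e * w i j = e * w' i j"
      using Q1[OF that(1)] Q1[OF that(2)] Q3[OF that(1)] Q3[OF that(2)] p2[OF that(1)] p2[OF that(2)]
        last unfolding w_def w'_def by algebra
    then show ?thesis using nz(4) by simp
  qed
  have x1: "x1 = x1'"
  proof -
    have "w 0 2 = c * x1" "w' 0 2 = c * x1'"
      unfolding w_def w'_def pE pE' by (simp_all add: algebra_simps)
    then show ?thesis using w[of 0 2] nz(3) by simp
  qed
  have y1: "y1 = y1'"
  proof -
    have "w 0 1 = - (a * c * y1)" "w' 0 1 = - (a * c * y1')"
      unfolding w_def w'_def pE pE' by (simp_all add: algebra_simps)
    then show ?thesis using w[of 0 1] nz(1,3) by simp
  qed
  have w12: "w 1 2 = c" "w' 1 2 = c"
    unfolding w_def w'_def pE pE' by (simp_all add: algebra_simps)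
  have m1: "m1 = m1'"
  proof -
    \<comment> \<open>Pairing \<open>Q3\<close> with the minors is the determinant of
      \<open>p\<close> with its first column replaced. The terms with \<open>n1\<close> and
      \<open>o1\<close> cancel, and \<open>m1\<close> is multiplied by the determinant
      \<open>a * b * c\<close> of \<open>p\<close>.\<close>
    have "(m1 * p (E 0) 0 + n1 * p (E 1) 0 + o1 * p (E 2) 0) * w 1 2
        - (m1 * p (E 0) 1 + n1 * p (E 1) 1 + o1 * p (E 2) 1) * w 0 2
        + (m1 * p (E 0) 2 + n1 * p (E 1) 2 + o1 * p (E 2) 2) * w 0 1 = m1 * (a * b * c)"
      unfolding w_def pE by (simp add: algebra_simps)
    moreover have "(m1' * p' (E 0) 0 + n1' * p' (E 1) 0 + o1' * p' (E 2) 0) * w' 1 2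
        - (m1' * p' (E 0) 1 + n1' * p' (E 1) 1 + o1' * p' (E 2) 1) * w' 0 2
        + (m1' * p' (E 0) 2 + n1' * p' (E 1) 2 + o1' * p' (E 2) 2) * w' 0 1 = m1' * (a * b * c)"
      unfolding w'_def pE' by (simp add: algebra_simps)
    ultimately have "m1 * (a * b * c) = m1' * (a * b * c)"
      using Q3 w by (metis insertI1 insertI2)
    then show ?thesis using nz(1-3) by simp
  qed
  have p0: "p (E 0) i = p' (E 0) i" if "i \<in> {0, 1, 2}" for i
    using Q0[OF that] m1 last nz'(2) by simp
  have y2: "y2 = y2'"
    using p0[of 2] unfolding pE pE' by simp
  have x2: "x2 = x2'"
    using p0[of 1] nz'(1) unfolding pE pE' y1 y2 by simp
  have z1: "z1 = z1'"
    using p2[of 1] unfolding pE pE' x2 y1 by simp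
  have n1: "n1 = n1'"
  proof -
    \<comment> \<open>Combining rows 1 and 2 of \<open>Q3\<close> eliminates \<open>o1\<close>; the
      terms with \<open>m1\<close> already agree.\<close>
    have "n1 * w 1 2 = n1' * w' 1 2"
      using Q3[of 1] Q3[of 2] p0[of 1] p0[of 2] p2[of 1] p2[of 2] m1
      unfolding w_def w'_def by simp algebra
    then show ?thesis using w12 nz(3) by simp
  qed
  have "p (E 1) 2 = p' (E 1) 2"
    using Q1[of 2] p0[of 2] m1 n1 last nz'(3) by simp
  then have z2: "z2 = z2'"
    unfolding pE pE' .
  have "o1 = o1'"
    using Q3[of 2] unfolding pE pE' m1 n1 y2 z2 by simp
  then show ?thesis
    using x1 x2 y1 y2 z1 z2 m1 n1 last by simp
qed


subsection \<open>The tetrahedron equation\<close>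

lemma T6_eq_t6: "T6 a b c = t6 (const a) (const b) (const c) (var 0) (var 1) (var 2) (var 3) (var 4) (var 5)"
  by (simp add: T6_def t6_def t6_den_def Let_def)

lemmas (in embedding) has_value_arith = has_value_const has_value_var has_value_add has_value_mult
  has_value_diff has_value_divide

lemma (in embedding) has_value_t6_den:
  assumes "has_value h \<sigma> x1 x1'" "has_value h \<sigma> x2 x2'" "has_value h \<sigma> y1 y1'"
    "has_value h \<sigma> y2 y2'" "has_value h \<sigma> z1 z1'" "has_value h \<sigma> z2 z2'"
  shows "has_value h \<sigma> (t6_den (const a) (const b) (const c) x1 x2 y1 y2 z1 z2)
    (t6_den (h a) (h b) (h c) x1' x2' y1' y2' z1' z2')"
  unfolding t6_den_def by (intro has_value_arith assms)

lemma (in embedding) has_value_t6: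
  assumes "has_value h \<sigma> x1 x1'" "has_value h \<sigma> x2 x2'" "has_value h \<sigma> y1 y1'"
    "has_value h \<sigma> y2 y2'" "has_value h \<sigma> z1 z1'" "has_value h \<sigma> z2 z2'"
    and "a \<noteq> 0" "c \<noteq> 0" "t6_den (h a) (h b) (h c) x1' x2' y1' y2' z1' z2' \<noteq> 0"
  shows "list_all2 (has_value h \<sigma>) (t6 (const a) (const b) (const c) x1 x2 y1 y2 z1 z2)
    (t6 (h a) (h b) (h c) x1' x2' y1' y2' z1' z2')"
proof -
  have "h c \<noteq> 0" "h a * h c \<noteq> 0"
    using assms(7,8) h_nonzero by auto
  then show ?thesis
    unfolding t6_def list_all2_Cons list_all2_Nil
    by (intro conjI refl has_value_arith has_value_t6_den assms)
qed

text \<open>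
  The maps \<open>T6 a b c\<close> are regular at the origin and fix it, and their denominator takes the value
  \<open>a b c\<close> there. So no denominator arising in a composition of them is the zero function.
\<close>

definition vanishes_at_0 :: "ratfun \<Rightarrow> bool" where
  "vanishes_at_0 f \<longleftrightarrow> has_value id (\<lambda>_. 0) f 0"

lemma vanishes_at_0_var: "vanishes_at_0 (var i)"
  unfolding vanishes_at_0_def using id_embedding.has_value_var[of "\<lambda>_. 0" i] by simp

text \<open>The value at the origin is \<open>a\<close>. This supplies the nonvanishing conditions
  for the uniqueness of the factorization.\<close>

lemma const_plus_vanishing_nonzero:
  assumes "a \<noteq> 0" "vanishes_at_0 f" "vanishes_at_0 g"
  shows "const a + f * g \<noteq> 0"
proof -
  have "has_value id (\<lambda>_. 0) (const a + f * g) (id a + 0 * 0)"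
    using assms(2,3) unfolding vanishes_at_0_def by (intro id_embedding.has_value_arith)
  then show ?thesis using id_embedding.nonzero_if_has_value assms(1) by fastforce
qed

lemma t6_den_nonzero:
  assumes "a \<noteq> 0" "b \<noteq> 0" "c \<noteq> 0"
    and "list_all vanishes_at_0 [x1, x2, y1, y2, z1, z2]"
  shows "t6_den (const a) (const b) (const c) x1 x2 y1 y2 z1 z2 \<noteq> 0"
proof -
  have "has_value id (\<lambda>_. 0) (t6_den (const a) (const b) (const c) x1 x2 y1 y2 z1 z2)
      (t6_den (id a) (id b) (id c) 0 0 0 0 0 0)"
    by (rule id_embedding.has_value_t6_den) (use assms(4) in \<open>auto simp: vanishes_at_0_def\<close>)
  then show ?thesis
    by (rule id_embedding.nonzero_if_has_value) (use assms(1-3) in \<open>simp add: t6_den_def\<close>)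
qed

lemma t6_vanishes_at_0:
  assumes nz: "a \<noteq> 0" "b \<noteq> 0" "c \<noteq> 0"
    and "list_all vanishes_at_0 [x1, x2, y1, y2, z1, z2]"
  shows "list_all vanishes_at_0 (t6 (const a) (const b) (const c) x1 x2 y1 y2 z1 z2)"
proof -
  have "list_all2 (has_value id (\<lambda>_. 0)) (t6 (const a) (const b) (const c) x1 x2 y1 y2 z1 z2)
      (t6 (id a) (id b) (id c) 0 0 0 0 0 0)"
    by (rule id_embedding.has_value_t6) (use assms in \<open>auto simp: vanishes_at_0_def t6_den_def\<close>)
  then show ?thesis by (simp add: t6_def vanishes_at_0_def)
qed

lemma has_value_t6_var:
  assumes "a \<noteq> 0" "b \<noteq> 0" "c \<noteq> 0"
    and "list_all vanishes_at_0 [\<rho> i1, \<rho> i2, \<rho> i3, \<rho> i4, \<rho> i5, \<rho> i6]"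
  shows "list_all2 (has_value const \<rho>)
      (t6 (const a) (const b) (const c) (var i1) (var i2) (var i3) (var i4) (var i5) (var i6))
      (t6 (const a) (const b) (const c) (\<rho> i1) (\<rho> i2) (\<rho> i3) (\<rho> i4) (\<rho> i5) (\<rho> i6))"
  by (intro const_embedding.has_value_t6 const_embedding.has_value_var t6_den_nonzero assms)

section \<open>Compositions of the maps on three and on six factors\<close>

lemma comp_map_T6:
  assumes "a \<noteq> 0" "b \<noteq> 0" "c \<noteq> 0"
    and "list_all vanishes_at_0 [x1, x2, y1, y2, z1, z2]"
  shows "comp_map (T6 a b c) [x1, x2, y1, y2, z1, z2]
       = Some (t6 (const a) (const b) (const c) x1 x2 y1 y2 z1 z2)"
  unfolding comp_map_eq_Some_iff T6_eq_t6
  using has_value_t6_var[OF assms(1-3), of "(!) [x1, x2, y1, y2, z1, z2]" 0 1 2 3 4 5] assms(4) by simp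

text \<open>A premise names the image, so that a composition is computed one map at a time without
  growing terms. The four cases are the placements in the tetrahedron equation.\<close>

lemma comp_map_act_on:
  assumes nz: "a \<noteq> 0" "b \<noteq> 0" "c \<noteq> 0"
    and v: "list_all vanishes_at_0 [g0, g1, g2, g3, g4, g5, g6, g7, g8, g9, g10, g11]"
  defines "G \<equiv> [g0, g1, g2, g3, g4, g5, g6, g7, g8, g9, g10, g11]"
    and "t \<equiv> t6 (const a) (const b) (const c)"
  shows "t g0 g1 g2 g3 g4 g5 = [u1, u2, v1, v2, w1, w2] \<Longrightarrow>
      comp_map (act_on (T6 a b c) 1 2 3) G = Some [u1, u2, v1, v2, w1, w2, g6, g7, g8, g9, g10, g11]"
    and "t g0 g1 g6 g7 g8 g9 = [u1, u2, v1, v2, w1, w2] \<Longrightarrow>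
      comp_map (act_on (T6 a b c) 1 4 5) G = Some [u1, u2, g2, g3, g4, g5, v1, v2, w1, w2, g10, g11]"
    and "t g2 g3 g6 g7 g10 g11 = [u1, u2, v1, v2, w1, w2] \<Longrightarrow>
      comp_map (act_on (T6 a b c) 2 4 6) G = Some [g0, g1, u1, u2, g4, g5, v1, v2, g8, g9, w1, w2]"
    and "t g4 g5 g8 g9 g10 g11 = [u1, u2, v1, v2, w1, w2] \<Longrightarrow>
      comp_map (act_on (T6 a b c) 3 5 6) G = Some [g0, g1, g2, g3, u1, u2, g6, g7, v1, v2, w1, w2]"
proof -
  \<comment> \<open>Variables vanish at the origin, so the renaming inside \<open>act_on\<close> is
    a case of \<open>comp_map_T6\<close> and the composition under \<open>the\<close> is
    defined.\<close>
  have ren: "comp_map (T6 a b c) (factor i @ factor j @ factor k) = Some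
      (t (var (2 * (i - 1))) (var (2 * (i - 1) + 1)) (var (2 * (j - 1))) (var (2 * (j - 1) + 1))
         (var (2 * (k - 1))) (var (2 * (k - 1) + 1)))" for i j k
    unfolding t_def factor_def append.simps
    by (rule comp_map_T6[OF nz]) (simp add: vanishes_at_0_var)
  have val: "list_all2 (has_value const ((!) G))
      (t (var i1) (var i2) (var i3) (var i4) (var i5) (var i6))
      (t (G ! i1) (G ! i2) (G ! i3) (G ! i4) (G ! i5) (G ! i6))"
    if "list_all (\<lambda>i. i < 12) [i1, i2, i3, i4, i5, i6]" for i1 i2 i3 i4 i5 i6
  proof -
    have "vanishes_at_0 (G ! i)" if "i < 12" for i
      using v that list_all_length[of vanishes_at_0 G] by (simp add: G_def)
    then show ?thesis
      unfolding t_def by (intro has_value_t6_var nz) (use that in auto)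
  qed
  \<comment> \<open>Opaque names for the components allow list positions to be computed without
    unfolding the formulas.\<close>
  obtain e1 e2 e3 e4 e5 e6 where t_Cons:
    "t x1 x2 y1 y2 z1 z2 = [e1 x1 x2 y1 y2 z1 z2, e2 x1 x2 y1 y2 z1 z2, e3 x1 x2 y1 y2 z1 z2,
       e4 x1 x2 y1 y2 z1 z2, e5 x1 x2 y1 y2 z1 z2, e6 x1 x2 y1 y2 z1 z2]" for x1 x2 y1 y2 z1 z2
    unfolding t_def t6_def by simp
  note has_var = const_embedding.has_value_var[of "(!) G"]
  have g: "G ! 0 = g0" "G ! 1 = g1" "G ! 2 = g2" "G ! 3 = g3" "G ! 4 = g4" "G ! 5 = g5"
    "G ! 6 = g6" "G ! 7 = g7" "G ! 8 = g8" "G ! 9 = g9" "G ! 10 = g10" "G ! 11 = g11"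
    by (simp_all add: G_def)
  have upt: "[1..<7] = [1, 2, 3, 4, 5, 6::nat]"
    by (simp add: upt_conv_Cons)
  note unfolds = comp_map_eq_Some_iff act_on_def ren option.sel Let_def upt
  show "comp_map (act_on (T6 a b c) 1 2 3) G = Some [u1, u2, v1, v2, w1, w2, g6, g7, g8, g9, g10, g11]"
    if "t g0 g1 g2 g3 g4 g5 = [u1, u2, v1, v2, w1, w2]"
    unfolding unfolds using val[of 0 1 2 3 4 5] that has_var[of 6] has_var[of 7] has_var[of 8] has_var[of 9]
      has_var[of 10] has_var[of 11] by (simp add: factor_def t_Cons g del: One_nat_def)
  show "comp_map (act_on (T6 a b c) 1 4 5) G = Some [u1, u2, g2, g3, g4, g5, v1, v2, w1, w2, g10, g11]"
    if "t g0 g1 g6 g7 g8 g9 = [u1, u2, v1, v2, w1, w2]"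
    unfolding unfolds using val[of 0 1 6 7 8 9] that has_var[of 2] has_var[of 3] has_var[of 4] has_var[of 5]
      has_var[of 10] has_var[of 11] by (simp add: factor_def t_Cons g del: One_nat_def)
  show "comp_map (act_on (T6 a b c) 2 4 6) G = Some [g0, g1, u1, u2, g4, g5, v1, v2, g8, g9, w1, w2]"
    if "t g2 g3 g6 g7 g10 g11 = [u1, u2, v1, v2, w1, w2]"
    unfolding unfolds using val[of 2 3 6 7 10 11] that has_var[of 0] has_var[of 1] has_var[of 4] has_var[of 5]
      has_var[of 8] has_var[of 9] by (simp add: factor_def t_Cons g del: One_nat_def)
  show "comp_map (act_on (T6 a b c) 3 5 6) G = Some [g0, g1, g2, g3, u1, u2, g6, g7, v1, v2, w1, w2]"
    if "t g4 g5 g8 g9 g10 g11 = [u1, u2, v1, v2, w1, w2]"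
    unfolding unfolds using val[of 4 5 8 9 10 11] that has_var[of 0] has_var[of 1] has_var[of 2] has_var[of 3]
      has_var[of 6] has_var[of 7] by (simp add: factor_def t_Cons g del: One_nat_def)
qed

text \<open>Vanishing at the origin passes from input to output, so the step can be repeated along a
  composition.\<close>

lemma t6_step:
  assumes nz: "a \<noteq> 0" "b \<noteq> 0" "c \<noteq> 0"
    and v: "list_all vanishes_at_0 [x1, x2, y1, y2, z1, z2]"
  obtains u1 u2 v1 v2 w1 w2 where
    "t6 (const a) (const b) (const c) x1 x2 y1 y2 z1 z2 = [u1, u2, v1, v2, w1, w2]"
    "list_all vanishes_at_0 [u1, u2, v1, v2, w1, w2]"
    "local_Yang_Baxter (const a) (const b) (const c) x1 x2 y1 y2 z1 z2 u1 u2 v1 v2 w1 w2"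
proof -
  obtain u1 u2 v1 v2 w1 w2 where
    t: "t6 (const a) (const b) (const c) x1 x2 y1 y2 z1 z2 = [u1, u2, v1, v2, w1, w2]"
    unfolding t6_def by blast
  show ?thesis
  proof (rule that[OF t])
    show "list_all vanishes_at_0 [u1, u2, v1, v2, w1, w2]"
      using t6_vanishes_at_0[OF assms] by (simp add: t)
    show "local_Yang_Baxter (const a) (const b) (const c) x1 x2 y1 y2 z1 z2 u1 u2 v1 v2 w1 w2"
      by (intro t6_local_Yang_Baxter[OF _ _ _ t] t6_den_nonzero assms const_embedding.h_nonzero)
  qed
qed

lemma tetrahedron_T6:
  assumes nz: "a \<noteq> 0" "b \<noteq> 0" "c \<noteq> 0" "d \<noteq> 0" "e \<noteq> 0" "f \<noteq> 0"
  shows "\<exists>G. composite 12 [act_on (T6 a b c) 1 2 3, act_on (T6 a d e) 1 4 5,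
                          act_on (T6 b d f) 2 4 6, act_on (T6 c e f) 3 5 6] = Some G \<and>
            composite 12 [act_on (T6 c e f) 3 5 6, act_on (T6 b d f) 2 4 6,
                          act_on (T6 a d e) 1 4 5, act_on (T6 a b c) 1 2 3] = Some G"
proof -
  have id12: "id_map 12 = [var 0, var 1, var 2, var 3, var 4, var 5, var 6, var 7, var 8, var 9, var 10, var 11]"
    by (simp add: id_map_def upt_conv_Cons numeral_eq_Suc)
  note v0 = vanishes_at_0_var
  let ?x1 = "var 0" and ?x2 = "var 1" and ?y1 = "var 2" and ?y2 = "var 3" and ?z1 = "var 4"
    and ?z2 = "var 5" and ?m1 = "var 6" and ?m2 = "var 7" and ?n1 = "var 8" and ?n2 = "var 9"
    and ?o1 = "var 10" and ?o2 = "var 11"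
  \<comment> \<open>The rightmost map acts first: the left side is built in the order 356, 246, 145,
    123. The variables named x, y, z, m, n, o belong to the factors 1 to 6.\<close>
  have v: "list_all vanishes_at_0 [?z1, ?z2, ?n1, ?n2, ?o1, ?o2]"
    by (simp add: v0)
  obtain z1 z2 n1 n2 o1 o2 where A:
    "t6 (const c) (const e) (const f) ?z1 ?z2 ?n1 ?n2 ?o1 ?o2 = [z1, z2, n1, n2, o1, o2]"
    and Av: "list_all vanishes_at_0 [z1, z2, n1, n2, o1, o2]"
    and AR: "local_Yang_Baxter (const c) (const e) (const f) ?z1 ?z2 ?n1 ?n2 ?o1 ?o2 z1 z2 n1 n2 o1 o2"
    by (rule t6_step[OF nz(3,5,6) v])
  have v: "list_all vanishes_at_0 [?y1, ?y2, ?m1, ?m2, o1, o2]"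
    using Av by (simp add: v0)
  obtain y1 y2 m1 m2 p1 p2 where B:
    "t6 (const b) (const d) (const f) ?y1 ?y2 ?m1 ?m2 o1 o2 = [y1, y2, m1, m2, p1, p2]"
    and Bv: "list_all vanishes_at_0 [y1, y2, m1, m2, p1, p2]"
    and BR: "local_Yang_Baxter (const b) (const d) (const f) ?y1 ?y2 ?m1 ?m2 o1 o2 y1 y2 m1 m2 p1 p2"
    by (rule t6_step[OF nz(2,4,6) v])
  have v: "list_all vanishes_at_0 [?x1, ?x2, m1, m2, n1, n2]"
    using Av Bv by (simp add: v0)
  obtain x1 x2 l1 l2 q1 q2 where C:
    "t6 (const a) (const d) (const e) ?x1 ?x2 m1 m2 n1 n2 = [x1, x2, l1, l2, q1, q2]"
    and Cv: "list_all vanishes_at_0 [x1, x2, l1, l2, q1, q2]"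
    and CR: "local_Yang_Baxter (const a) (const d) (const e) ?x1 ?x2 m1 m2 n1 n2 x1 x2 l1 l2 q1 q2"
    by (rule t6_step[OF nz(1,4,5) v])
  have v: "list_all vanishes_at_0 [x1, x2, y1, y2, z1, z2]"
    using Av Bv Cv by simp
  obtain r1 r2 s1 s2 t1 t2 where D:
    "t6 (const a) (const b) (const c) x1 x2 y1 y2 z1 z2 = [r1, r2, s1, s2, t1, t2]"
    and Dv: "list_all vanishes_at_0 [r1, r2, s1, s2, t1, t2]"
    and DR: "local_Yang_Baxter (const a) (const b) (const c) x1 x2 y1 y2 z1 z2 r1 r2 s1 s2 t1 t2"
    by (rule t6_step[OF nz(1,2,3) v])
  have lhs: "composite 12 [act_on (T6 a b c) 1 2 3, act_on (T6 a d e) 1 4 5,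
        act_on (T6 b d f) 2 4 6, act_on (T6 c e f) 3 5 6]
      = Some [r1, r2, s1, s2, t1, t2, l1, l2, q1, q2, p1, p2]"
    using Av Bv Cv Dv nz
    by (simp add: composite_def id12 v0 comp_map_act_on(4)[OF _ _ _ _ A]
        comp_map_act_on(3)[OF _ _ _ _ B] comp_map_act_on(2)[OF _ _ _ _ C]
        comp_map_act_on(1)[OF _ _ _ _ D] del: One_nat_def)
  have v: "list_all vanishes_at_0 [?x1, ?x2, ?y1, ?y2, ?z1, ?z2]"
    by (simp add: v0)
  obtain x1' x2' y1' y2' z1' z2' where A':
    "t6 (const a) (const b) (const c) ?x1 ?x2 ?y1 ?y2 ?z1 ?z2 = [x1', x2', y1', y2', z1', z2']"
    and Av': "list_all vanishes_at_0 [x1', x2', y1', y2', z1', z2']"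
    and AR': "local_Yang_Baxter (const a) (const b) (const c) ?x1 ?x2 ?y1 ?y2 ?z1 ?z2 x1' x2' y1' y2' z1' z2'"
    by (rule t6_step[OF nz(1,2,3) v])
  have v: "list_all vanishes_at_0 [x1', x2', ?m1, ?m2, ?n1, ?n2]"
    using Av' by (simp add: v0)
  obtain r1' r2' m1' m2' n1' n2' where B':
    "t6 (const a) (const d) (const e) x1' x2' ?m1 ?m2 ?n1 ?n2 = [r1', r2', m1', m2', n1', n2']"
    and Bv': "list_all vanishes_at_0 [r1', r2', m1', m2', n1', n2']"
    and BR': "local_Yang_Baxter (const a) (const d) (const e) x1' x2' ?m1 ?m2 ?n1 ?n2 r1' r2' m1' m2' n1' n2'"
    by (rule t6_step[OF nz(1,4,5) v])
  have v: "list_all vanishes_at_0 [y1', y2', m1', m2', ?o1, ?o2]"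
    using Av' Bv' by (simp add: v0)
  obtain s1' s2' l1' l2' o1' o2' where C':
    "t6 (const b) (const d) (const f) y1' y2' m1' m2' ?o1 ?o2 = [s1', s2', l1', l2', o1', o2']"
    and Cv': "list_all vanishes_at_0 [s1', s2', l1', l2', o1', o2']"
    and CR': "local_Yang_Baxter (const b) (const d) (const f) y1' y2' m1' m2' ?o1 ?o2 s1' s2' l1' l2' o1' o2'"
    by (rule t6_step[OF nz(2,4,6) v])
  have v: "list_all vanishes_at_0 [z1', z2', n1', n2', o1', o2']"
    using Av' Bv' Cv' by simp
  obtain t1' t2' q1' q2' p1' p2' where D':
    "t6 (const c) (const e) (const f) z1' z2' n1' n2' o1' o2' = [t1', t2', q1', q2', p1', p2']"
    and Dv': "list_all vanishes_at_0 [t1', t2', q1', q2', p1', p2']"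
    and DR': "local_Yang_Baxter (const c) (const e) (const f) z1' z2' n1' n2' o1' o2' t1' t2' q1' q2' p1' p2'"
    by (rule t6_step[OF nz(3,5,6) v])
  have rhs: "composite 12 [act_on (T6 c e f) 3 5 6, act_on (T6 b d f) 2 4 6,
        act_on (T6 a d e) 1 4 5, act_on (T6 a b c) 1 2 3]
      = Some [r1', r2', s1', s2', t1', t2', l1', l2', q1', q2', p1', p2']"
    using Av' Bv' Cv' Dv' nz
    by (simp add: composite_def id12 v0 comp_map_act_on(1)[OF _ _ _ _ A']
        comp_map_act_on(2)[OF _ _ _ _ B'] comp_map_act_on(3)[OF _ _ _ _ C']
        comp_map_act_on(4)[OF _ _ _ _ D'] del: One_nat_def)
  let ?a = "const a" and ?b = "const b" and ?c = "const c" and ?d = "const d" and ?e = "const e"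
    and ?f = "const f"
  have nz': "?a \<noteq> 0" "?b \<noteq> 0" "?c \<noteq> 0" "?e \<noteq> 0" "?f \<noteq> 0"
    using nz by (simp_all add: const_embedding.h_nonzero)
  have "[r1, r2, s1, s2, t1, t2, l1, l2, q1, q2, p1, p2]
      = [r1', r2', s1', s2', t1', t2', l1', l2', q1', q2', p1', p2']"
  proof (rule rot_factorization_unique[OF nz'])
    show "?b + s1 * s2 \<noteq> 0" "?d + l1 * l2 \<noteq> 0" "?e + q1 * q2 \<noteq> 0"
      using Cv Dv nz by (simp_all add: const_plus_vanishing_nonzero)
    fix v
    \<comment> \<open>Four uses of the local Yang-Baxter equation, with commutations in between,
      undo the left composite and reach the product in the original variables. Four more then follow
      the right composite.\<close>
    have "rot 0 1 ?a r1 r2 (rot 0 2 ?b s1 s2 (rot 1 2 ?c t1 t2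
           (rot 0 3 ?d l1 l2 (rot 1 3 ?e q1 q2 (rot 2 3 ?f p1 p2 v)))))
        = rot 1 2 ?c z1 z2 (rot 0 2 ?b y1 y2 (rot 0 1 ?a x1 x2
           (rot 0 3 ?d l1 l2 (rot 1 3 ?e q1 q2 (rot 2 3 ?f p1 p2 v)))))"
      by (simp add: local_Yang_BaxterD[OF DR] del: One_nat_def)
    also have "\<dots> = rot 1 2 ?c z1 z2 (rot 0 2 ?b y1 y2
           (rot 1 3 ?e n1 n2 (rot 0 3 ?d m1 m2 (rot 0 1 ?a ?x1 ?x2 (rot 2 3 ?f p1 p2 v)))))"
      by (simp add: local_Yang_BaxterD[OF CR] del: One_nat_def)
    also have "\<dots> = rot 1 2 ?c z1 z2 (rot 1 3 ?e n1 n2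
           (rot 0 2 ?b y1 y2 (rot 0 3 ?d m1 m2 (rot 2 3 ?f p1 p2 (rot 0 1 ?a ?x1 ?x2 v)))))"
      by (simp add: rot_commute[of 0 1 2 3] rot_commute[of 0 2 1 3] del: One_nat_def)
    also have "\<dots> = rot 1 2 ?c z1 z2 (rot 1 3 ?e n1 n2
           (rot 2 3 ?f o1 o2 (rot 0 3 ?d ?m1 ?m2 (rot 0 2 ?b ?y1 ?y2 (rot 0 1 ?a ?x1 ?x2 v)))))"
      by (simp add: local_Yang_BaxterD[OF BR] del: One_nat_def)
    also have "\<dots> = rot 2 3 ?f ?o1 ?o2 (rot 1 3 ?e ?n1 ?n2 (rot 1 2 ?c ?z1 ?z2
           (rot 0 3 ?d ?m1 ?m2 (rot 0 2 ?b ?y1 ?y2 (rot 0 1 ?a ?x1 ?x2 v)))))"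
      by (simp add: local_Yang_BaxterD[OF AR] del: One_nat_def)
    also have "\<dots> = rot 2 3 ?f ?o1 ?o2 (rot 1 3 ?e ?n1 ?n2 (rot 0 3 ?d ?m1 ?m2
           (rot 1 2 ?c ?z1 ?z2 (rot 0 2 ?b ?y1 ?y2 (rot 0 1 ?a ?x1 ?x2 v)))))"
      by (simp add: rot_commute[of 0 3 1 2] del: One_nat_def)
    also have "\<dots> = rot 2 3 ?f ?o1 ?o2 (rot 1 3 ?e ?n1 ?n2 (rot 0 3 ?d ?m1 ?m2
           (rot 0 1 ?a x1' x2' (rot 0 2 ?b y1' y2' (rot 1 2 ?c z1' z2' v)))))"
      by (simp add: local_Yang_BaxterD[OF AR'] del: One_nat_def)
    also have "\<dots> = rot 2 3 ?f ?o1 ?o2 (rot 0 1 ?a r1' r2' (rot 0 3 ?d m1' m2'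
           (rot 1 3 ?e n1' n2' (rot 0 2 ?b y1' y2' (rot 1 2 ?c z1' z2' v)))))"
      by (simp add: local_Yang_BaxterD[OF BR'] del: One_nat_def)
    also have "\<dots> = rot 0 1 ?a r1' r2' (rot 2 3 ?f ?o1 ?o2 (rot 0 3 ?d m1' m2'
           (rot 0 2 ?b y1' y2' (rot 1 3 ?e n1' n2' (rot 1 2 ?c z1' z2' v)))))"
      by (simp add: rot_commute[of 2 3 0 1] rot_commute[of 1 3 0 2] del: One_nat_def)
    also have "\<dots> = rot 0 1 ?a r1' r2' (rot 0 2 ?b s1' s2' (rot 0 3 ?d l1' l2'
           (rot 2 3 ?f o1' o2' (rot 1 3 ?e n1' n2' (rot 1 2 ?c z1' z2' v)))))"
      by (simp add: local_Yang_BaxterD[OF CR'] del: One_nat_def)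
    also have "\<dots> = rot 0 1 ?a r1' r2' (rot 0 2 ?b s1' s2' (rot 0 3 ?d l1' l2'
           (rot 1 2 ?c t1' t2' (rot 1 3 ?e q1' q2' (rot 2 3 ?f p1' p2' v)))))"
      by (simp add: local_Yang_BaxterD[OF DR'] del: One_nat_def)
    also have "\<dots> = rot 0 1 ?a r1' r2' (rot 0 2 ?b s1' s2' (rot 1 2 ?c t1' t2'
           (rot 0 3 ?d l1' l2' (rot 1 3 ?e q1' q2' (rot 2 3 ?f p1' p2' v)))))"
      by (simp add: rot_commute[of 0 3 1 2] del: One_nat_def)
    finally show "rot 0 1 ?a r1 r2 (rot 0 2 ?b s1 s2 (rot 1 2 ?c t1 t2
           (rot 0 3 ?d l1 l2 (rot 1 3 ?e q1 q2 (rot 2 3 ?f p1 p2 v)))))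
        = rot 0 1 ?a r1' r2' (rot 0 2 ?b s1' s2' (rot 1 2 ?c t1' t2'
           (rot 0 3 ?d l1' l2' (rot 1 3 ?e q1' q2' (rot 2 3 ?f p1' p2' v)))))" .
  qed
  then show ?thesis using lhs rhs by auto
qed


subsection \<open>Invariants and noninvolutivity\<close>

text \<open>These are \<open>I2\<close> and \<open>I3\<close>; the invariance of \<open>I1\<close>
  is the first matrix entry in \<open>t6_equations\<close>.\<close>

lemma t6_invariants:
  fixes a b c :: "'k::field"
  assumes nz: "a \<noteq> 0" "c \<noteq> 0" "t6_den a b c x1 x2 y1 y2 z1 z2 \<noteq> 0"
    and t6: "t6 a b c x1 x2 y1 y2 z1 z2 = [u1, u2, v1, v2, w1, w2]"
  shows "(b + v1 * v2) * (c + w1 * w2) = (b + y1 * y2) * (c + z1 * z2)"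
    and "a * v1 * v2 + (u2 * v1 + w1) * (u1 * v2 + w2)
       = a * y1 * y2 + (x2 * y1 + z1) * (x1 * y2 + z2)"
proof -
  note eq = t6_equations[OF nz t6]
  have u1: "c * u1 = b * x1 - y1 * z2" and v1: "a * c * v1 = y1 * (c + z1 * z2) - b * x1 * z1"
    using nz(1,2) t6 by (auto simp: t6_def)
  \<comment> \<open>Only \<open>u2\<close> and \<open>w1\<close> contain the denominator
    \<open>t6_den\<close>. After this substitution \<open>u2\<close> cancels or occurs in
    \<open>u2 * (b + v1 * v2)\<close>, which is a known polynomial.\<close>
  have w1: "w1 = z1 - u2 * v1" using eq(3) by (simp add: eq_diff_eq)
  have "(b + v1 * v2) * (c + w1 * w2)
      = (b + v1 * v2) * (c + z1 * w2) - u2 * (b + v1 * v2) * v1 * w2"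
    unfolding w1 by (simp add: algebra_simps)
  also have "\<dots> = b * (c + z1 * w2) + a * c * v1 * y2"
    unfolding eq(2) unfolding eq(7,8) by (simp add: algebra_simps)
  also have "\<dots> = (b + y1 * y2) * (c + z1 * z2)"
    unfolding v1 eq(8) by (simp add: algebra_simps)
  finally show "(b + v1 * v2) * (c + w1 * w2) = (b + y1 * y2) * (c + z1 * z2)" .
  have "c * (a * v1 * v2 + (u2 * v1 + w1) * (u1 * v2 + w2))
      = a * c * v1 * v2 + z1 * (c * u1 * v2 + c * w2)"
    unfolding w1 by (simp add: algebra_simps)
  also have "\<dots> = c * (a * y1 * y2 + (x2 * y1 + z1) * (x1 * y2 + z2))"
    unfolding u1 v1 eq(7,8) by (simp add: algebra_simps)
  finally show "a * v1 * v2 + (u2 * v1 + w1) * (u1 * v2 + w2)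
       = a * y1 * y2 + (x2 * y1 + z1) * (x1 * y2 + z2)"
    using nz(2) by simp
qed

lemma invariant_of_iff: "invariant_of I F \<longleftrightarrow> has_value const ((!) F) I I"
  by (simp add: invariant_of_def const_embedding.rat_value_eq_Some_iff)

lemma T6_invariant_of:
  assumes nz: "a \<noteq> 0" "b \<noteq> 0" "c \<noteq> 0"
  shows "invariant_of (I1 a b c) (T6 a b c)" "invariant_of (I2 a b c) (T6 a b c)"
    "invariant_of (I3 a b c) (T6 a b c)"
proof -
  obtain u1 u2 v1 v2 w1 w2 where
    t: "t6 (const a) (const b) (const c) (var 0) (var 1) (var 2) (var 3) (var 4) (var 5)
      = [u1, u2, v1, v2, w1, w2]"
    unfolding t6_def by blast
  have T: "T6 a b c = [u1, u2, v1, v2, w1, w2]"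
    by (simp only: T6_eq_t6 t)
  have den: "t6_den (const a) (const b) (const c) (var 0) (var 1) (var 2) (var 3) (var 4) (var 5) \<noteq> 0"
    by (rule t6_den_nonzero[OF nz]) (simp add: vanishes_at_0_var)
  note ca = const_embedding.h_nonzero[OF nz(1)] and cc = const_embedding.h_nonzero[OF nz(3)]
  note eq = t6_equations(1)[OF ca cc den t] t6_invariants[OF ca cc den t]
  let ?\<sigma> = "(!) (T6 a b c)"
  have nth: "?\<sigma> 0 = u1" "?\<sigma> 1 = u2" "?\<sigma> 2 = v1" "?\<sigma> 3 = v2" "?\<sigma> 4 = w1" "?\<sigma> 5 = w2"
    by (simp_all add: T)
  have "has_value const ?\<sigma> (I1 a b c) ((const a + ?\<sigma> 0 * ?\<sigma> 1) * (const b + ?\<sigma> 2 * ?\<sigma> 3))"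
    unfolding I1_def by (intro const_embedding.has_value_arith)
  then show "invariant_of (I1 a b c) (T6 a b c)"
    unfolding invariant_of_iff nth eq(1) by (simp only: I1_def)
  have "has_value const ?\<sigma> (I2 a b c) ((const b + ?\<sigma> 2 * ?\<sigma> 3) * (const c + ?\<sigma> 4 * ?\<sigma> 5))"
    unfolding I2_def by (intro const_embedding.has_value_arith)
  then show "invariant_of (I2 a b c) (T6 a b c)"
    unfolding invariant_of_iff nth eq(2) by (simp only: I2_def)
  have "has_value const ?\<sigma> (I3 a b c) (const a * ?\<sigma> 2 * ?\<sigma> 3
      + (?\<sigma> 1 * ?\<sigma> 2 + ?\<sigma> 4) * (?\<sigma> 0 * ?\<sigma> 3 + ?\<sigma> 5))"
    unfolding I3_def by (intro const_embedding.has_value_arith)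
  then show "invariant_of (I3 a b c) (T6 a b c)"
    unfolding invariant_of_iff nth eq(3) by (simp only: I3_def)
qed

lemma noninvolutive_T6:
  assumes nz: "a \<noteq> 0" "b \<noteq> 0" "c \<noteq> 0"
  shows "noninvolutive 6 (T6 a b c)"
proof -
  let ?T = "t6 (const a) (const b) (const c)"
  have id6: "id_map 6 = [var 0, var 1, var 2, var 3, var 4, var 5]"
    by (simp add: id_map_def upt_conv_Cons numeral_eq_Suc)
  have v: "list_all vanishes_at_0 [var 0, var 1, var 2, var 3, var 4, var 5]"
    by (simp add: vanishes_at_0_var)
  obtain u1 u2 v1 v2 w1 w2 where
    t: "?T (var 0) (var 1) (var 2) (var 3) (var 4) (var 5) = [u1, u2, v1, v2, w1, w2]"
    and tv: "list_all vanishes_at_0 [u1, u2, v1, v2, w1, w2]"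
    by (rule t6_step[OF nz v])
  have comp: "composite 6 [T6 a b c, T6 a b c] = Some (?T u1 u2 v1 v2 w1 w2)"
    using comp_map_T6[OF nz v] comp_map_T6[OF nz tv] by (simp add: composite_def id6 t del: One_nat_def)
  \<comment> \<open>On \<open>x1 = x2 = 0\<close> the last component \<open>u1 * v2 + w2\<close> of
    the square is \<open>z2 - a * y1 * y2 * z2 / c\<close>. Here it equals \<open>1 + a / c\<close>,
    whereas \<open>z2 = 1\<close>.\<close>
  define \<sigma> :: "nat \<Rightarrow> complex" where "\<sigma> = (\<lambda>_. 0)(2 := - 1, 3 := 1, 5 := 1)"
  have "?T u1 u2 v1 v2 w1 w2 \<noteq> id_map 6"
  proof
    assume "?T u1 u2 v1 v2 w1 w2 = id_map 6"
    then have eq: "u1 * v2 + w2 = var 5"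
      by (simp add: t6_def id6)
    have u: "u1 = (const b * var 0 - var 2 * var 5) / const c"
      "v2 = var 1 * var 5 + var 3 * (const a + var 0 * var 1)"
      "w2 = var 0 * var 3 + var 5"
      using t by (simp_all add: t6_def)
    have "has_value id \<sigma> (u1 * v2 + w2)
        ((id b * \<sigma> 0 - \<sigma> 2 * \<sigma> 5) / id c * (\<sigma> 1 * \<sigma> 5 + \<sigma> 3 * (id a + \<sigma> 0 * \<sigma> 1))
          + (\<sigma> 0 * \<sigma> 3 + \<sigma> 5))"
      unfolding u by (intro id_embedding.has_value_arith) (use nz(3) in simp)
    then have "has_value id \<sigma> (var 5) (a / c + 1)"
      unfolding eq by (simp add: \<sigma>_def)
    then have "a / c + 1 = \<sigma> 5"
      using id_embedding.has_value_unique id_embedding.has_value_var by blast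
    then show False using nz by (simp add: \<sigma>_def)
  qed
  with comp show ?thesis unfolding noninvolutive_def by blast
qed


subsection \<open>Restriction to the leaves\<close>

definition t9_den :: "'k::field \<Rightarrow> 'k \<Rightarrow> 'k \<Rightarrow> 'k \<Rightarrow> 'k \<Rightarrow> 'k \<Rightarrow> 'k \<Rightarrow> 'k \<Rightarrow> 'k \<Rightarrow> 'k" where
  "t9_den x1 x2 X y1 y2 Y z1 z2 Z =
     y1 * y2 * z1 * (x1 * y2 + z2) * X - (x1 * y2 * z1 + z1 * z2 - Z) * X * Y
       + x2 * (y1 * z2 + x1 * (y1 * y2 - Y)) * Z"

definition t9 :: "'k::field \<Rightarrow> 'k \<Rightarrow> 'k \<Rightarrow> 'k \<Rightarrow> 'k \<Rightarrow> 'k \<Rightarrow> 'k \<Rightarrow> 'k \<Rightarrow> 'k \<Rightarrow> 'k list" where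
  "t9 x1 x2 X y1 y2 Y z1 z2 Z =
     (let \<Delta> = t9_den x1 x2 X y1 y2 Y z1 z2 Z
      in [(x1 * (y1 * y2 - Y) + y1 * z2) / (z1 * z2 - Z),
          (x1 * x2 - X) * (y2 * z1 * X + x2 * Z) * (z1 * z2 - Z) / \<Delta>,
          (x1 * x2 - X) * (z1 * z2 - Z) * X * Y / \<Delta>,
          (x1 * z1 * (y1 * y2 - Y) + y1 * Z) / ((x1 * x2 - X) * (z1 * z2 - Z)),
          x2 * z2 + y2 * X,
          \<Delta> / ((x1 * x2 - X) * (z1 * z2 - Z)),
          (x2 * y1 * Z + z1 * (y1 * y2 - Y) * X) * (z1 * z2 - Z) / \<Delta>,
          x1 * y2 + z2,
          (x1 * x2 - X) * (z1 * z2 - Z) * Y * Z / \<Delta>])"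

lemma T9_eq_t9:
  "T9 = t9 (var 0) (var 1) (var 2) (var 3) (var 4) (var 5) (var 6) (var 7) (var 8)"
  by (simp add: T9_def t9_def t9_den_def Let_def)

lemma t9_den_leaf:
  "t9_den x1 x2 (a + x1 * x2) y1 y2 (b + y1 * y2) z1 z2 (c + z1 * z2) = t6_den a b c x1 x2 y1 y2 z1 z2"
  by (simp add: t9_den_def t6_den_def algebra_simps)

text \<open>The closed forms of \<open>U\<close>, \<open>V\<close>, \<open>W\<close> come from
  \<open>b + v1 * v2 = D / (a * c)\<close> and the invariance of its products with
  \<open>a + u1 * u2\<close> and \<open>c + w1 * w2\<close>.\<close>

lemma t9_leaf:
  fixes a b c :: "'k::field"
  assumes nz: "a \<noteq> 0" "c \<noteq> 0" "t6_den a b c x1 x2 y1 y2 z1 z2 \<noteq> 0"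
    and t6: "t6 a b c x1 x2 y1 y2 z1 z2 = [u1, u2, v1, v2, w1, w2]"
  shows "t9 x1 x2 (a + x1 * x2) y1 y2 (b + y1 * y2) z1 z2 (c + z1 * z2)
    = [u1, u2, a + u1 * u2, v1, v2, b + v1 * v2, w1, w2, c + w1 * w2]"
proof -
  define D where "D = t6_den a b c x1 x2 y1 y2 z1 z2"
  have D: "D \<noteq> 0" using nz(3) by (simp add: D_def)
  have D': "D = a * b * c - (x2 * z2 + y2 * (a + x1 * x2)) * (b * x1 * z1 - y1 * (c + z1 * z2))"
    by (simp add: D_def t6_den_def)
  have eqs: "u1 = (b * x1 - y1 * z2) / c"
      "u2 = a * c * (x2 * (c + z1 * z2) + y2 * z1 * (a + x1 * x2)) / D"
      "v1 = (y1 * (c + z1 * z2) - b * x1 * z1) / (a * c)"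
      "v2 = x2 * z2 + y2 * (a + x1 * x2)"
      "w1 = c * (b * z1 * (a + x1 * x2) - x2 * y1 * (c + z1 * z2)) / D"
      "w2 = x1 * y2 + z2"
    using t6 by (auto simp: t6_def D_def)
  have V: "b + v1 * v2 = D / (a * c)"
    unfolding eqs D' using nz(1,2) by (simp add: field_simps)
  have U: "a + u1 * u2 = a * c * (a + x1 * x2) * (b + y1 * y2) / D"
    using t6_equations(1)[OF nz t6] nz(1,2) D unfolding V by (simp add: field_simps)
  have W: "c + w1 * w2 = a * c * (b + y1 * y2) * (c + z1 * z2) / D"
    using t6_invariants(1)[OF nz t6] nz(1,2) D unfolding V by (simp add: field_simps)
  have diff: "s - (d + s) = - d" for s d :: 'k by simp
  show ?thesis
    unfolding t9_def t9_den_leaf D_def[symmetric] Let_def U V W diff unfolding eqs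
    using nz(1,2) D by (simp add: field_simps)
qed

text \<open>The generic point lies on leaves whose parameters are the functions \<open>a\<close>,
  \<open>b\<close>, \<open>c\<close>, so \<open>t9_leaf\<close> applies over the field of rational
  functions. Their invariance can be read off.\<close>

lemma T9_eq_leaf:
  defines "a \<equiv> var 2 - var 0 * var 1" and "b \<equiv> var 5 - var 3 * var 4"
    and "c \<equiv> var 8 - var 6 * var 7"
  obtains u1 u2 v1 v2 w1 w2 where
    "T9 = [u1, u2, a + u1 * u2, v1, v2, b + v1 * v2, w1, w2, c + w1 * w2]"
proof -
  obtain u1 u2 v1 v2 w1 w2 where
    t: "t6 a b c (var 0) (var 1) (var 3) (var 4) (var 6) (var 7) = [u1, u2, v1, v2, w1, w2]"
    unfolding t6_def by blast
  have X: "var 2 = a + var 0 * var 1" "var 5 = b + var 3 * var 4" "var 8 = c + var 6 * var 7"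
    by (simp_all add: a_def b_def c_def)
  have "t6_den a b c (var 0) (var 1) (var 3) (var 4) (var 6) (var 7) \<noteq> 0"
    using T9_denominators(3) unfolding t9_den_leaf[symmetric] X[symmetric] by (simp add: t9_den_def)
  then have "T9 = [u1, u2, a + u1 * u2, v1, v2, b + v1 * v2, w1, w2, c + w1 * w2]"
    unfolding T9_eq_t9 X
    by (intro t9_leaf t) (use T9_denominators(1,2) in \<open>auto simp: a_def c_def\<close>)
  then show ?thesis using that by blast
qed

lemma T9_invariant_of:
  "invariant_of \<Phi>9 T9" "invariant_of \<Psi>9 T9" "invariant_of \<Omega>9 T9"
proof -
  obtain u1 u2 v1 v2 w1 w2 where T: "T9 =
    [u1, u2, (var 2 - var 0 * var 1) + u1 * u2, v1, v2, (var 5 - var 3 * var 4) + v1 * v2,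
     w1, w2, (var 8 - var 6 * var 7) + w1 * w2]"
    by (rule T9_eq_leaf)
  have "has_value const ((!) T9) (var i - var j * var k) (T9 ! i - T9 ! j * T9 ! k)" for i j k
    by (intro const_embedding.has_value_arith)
  from this[of 2 0 1] this[of 5 3 4] this[of 8 6 7]
  show "invariant_of \<Phi>9 T9" "invariant_of \<Psi>9 T9" "invariant_of \<Omega>9 T9"
    unfolding invariant_of_iff \<Phi>9_def \<Psi>9_def \<Omega>9_def by (simp_all add: T)
qed

section \<open>Regular points of the nine-dimensional map\<close>

lemma has_value_t9_den:
  "has_value id \<rho> (t9_den (var 0) (var 1) (var 2) (var 3) (var 4) (var 5) (var 6) (var 7) (var 8))
     (t9_den (\<rho> 0) (\<rho> 1) (\<rho> 2) (\<rho> 3) (\<rho> 4) (\<rho> 5) (\<rho> 6) (\<rho> 7) (\<rho> 8))"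
  unfolding t9_den_def by (intro id_embedding.has_value_arith)

lemma map_at_T9:
  assumes "x1 * x2 - X \<noteq> 0" "z1 * z2 - Z \<noteq> 0" "t9_den x1 x2 X y1 y2 Y z1 z2 Z \<noteq> 0"
  shows "map_at T9 [x1, x2, X, y1, y2, Y, z1, z2, Z] = Some (t9 x1 x2 X y1 y2 Y z1 z2 Z)"
proof -
  let ?\<rho> = "(!) [x1, x2, X, y1, y2, Y, z1, z2, Z]"
  have "list_all2 (has_value id ?\<rho>) T9
     (t9 (?\<rho> 0) (?\<rho> 1) (?\<rho> 2) (?\<rho> 3) (?\<rho> 4) (?\<rho> 5) (?\<rho> 6) (?\<rho> 7) (?\<rho> 8))"
    unfolding T9_eq_t9 t9_def Let_def list_all2_Cons list_all2_Nil
    by (intro conjI refl id_embedding.has_value_arith has_value_t9_den) (use assms in simp_all)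
  then show ?thesis by (simp add: map_at_eq_Some_iff)
qed

text \<open>\<open>\<Delta>\<close> is affine in each of these five variables; the factor of
  \<open>t\<close> is the partial derivative.\<close>

lemma t9_den_add:
  "t9_den x1 x2 (X + t) y1 y2 Y z1 z2 Z = t9_den x1 x2 X y1 y2 Y z1 z2 Z
     + t * (y1 * y2 * z1 * (x1 * y2 + z2) - (x1 * y2 * z1 + z1 * z2 - Z) * Y)"
  "t9_den x1 x2 X y1 y2 (Y + t) z1 z2 Z = t9_den x1 x2 X y1 y2 Y z1 z2 Z
     + t * (- (x1 * y2 * z1 + z1 * z2 - Z) * X - x1 * x2 * Z)"
  "t9_den x1 x2 X y1 y2 Y z1 z2 (Z + t) = t9_den x1 x2 X y1 y2 Y z1 z2 Z
     + t * (X * Y + x2 * (y1 * z2 + x1 * (y1 * y2 - Y)))"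
  "t9_den x1 (x2 + t) X y1 y2 Y z1 z2 Z = t9_den x1 x2 X y1 y2 Y z1 z2 Z
     + t * ((y1 * z2 + x1 * (y1 * y2 - Y)) * Z)"
  "t9_den x1 x2 X y1 y2 Y (z1 + t) z2 Z = t9_den x1 x2 X y1 y2 Y z1 z2 Z
     + t * ((x1 * y2 + z2) * X * (y1 * y2 - Y))"
  by (simp_all add: t9_den_def algebra_simps)

text \<open>
  Regularity at a point does not immediately exclude a zero of the denominator \<open>\<Delta>\<close>, as the numerators
  may vanish there too. At such a point, a regular component \<open>N / \<Delta>\<close> of value \<open>v\<close> satisfies
  \<open>dN = v d\<Delta>\<close>. Comparing these proportionalities for the components \<open>u2\<close>, \<open>U\<close>, \<open>W\<close> gives a
  contradiction, except where \<open>X = Y = Z = 0\<close>. There a second-order expansion is used, along a line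
  tangent to \<open>\<Delta> = 0\<close>.
\<close>

lemma T9_regular_imp_den_nonzero:
  assumes nz: "x1 * x2 - X \<noteq> 0" "y1 * y2 - Y \<noteq> 0" "z1 * z2 - Z \<noteq> 0"
    and reg: "map_at T9 [x1, x2, X, y1, y2, Y, z1, z2, Z] \<noteq> None"
  shows "t9_den x1 x2 X y1 y2 Y z1 z2 Z \<noteq> 0"
proof
  assume D0: "t9_den x1 x2 X y1 y2 Y z1 z2 Z = 0"
  define \<sigma> where "\<sigma> = (!) [x1, x2, X, y1, y2, Y, z1, z2, Z]"
  have \<sigma>: "\<sigma> 0 = x1" "\<sigma> 1 = x2" "\<sigma> 2 = X" "\<sigma> 3 = y1" "\<sigma> 4 = y2" "\<sigma> 5 = Y" "\<sigma> 6 = z1" "\<sigma> 7 = z2" "\<sigma> 8 = Z" "\<sigma> (Suc 0) = x2"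
    by (simp_all add: \<sigma>_def)
  let ?\<Delta> = "t9_den (var 0) (var 1) (var 2) (var 3) (var 4) (var 5) (var 6) (var 7) (var 8)"
  let ?u = "(var 0 * var 1 - var 2) * (var 4 * var 6 * var 2 + var 1 * var 8) * (var 6 * var 7 - var 8)"
  let ?U = "(var 0 * var 1 - var 2) * (var 6 * var 7 - var 8) * var 2 * var 5"
  let ?W = "(var 0 * var 1 - var 2) * (var 6 * var 7 - var 8) * var 5 * var 8"
  define D where "D \<rho> = t9_den (\<rho> 0) (\<rho> 1) (\<rho> 2) (\<rho> 3) (\<rho> 4) (\<rho> 5) (\<rho> 6) (\<rho> 7) (\<rho> 8)"
    for \<rho> :: "nat \<Rightarrow> complex"
  define fu where "fu \<rho> = (\<rho> 0 * \<rho> 1 - \<rho> 2) * (\<rho> 4 * \<rho> 6 * \<rho> 2 + \<rho> 1 * \<rho> 8) * (\<rho> 6 * \<rho> 7 - \<rho> 8)"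
    for \<rho> :: "nat \<Rightarrow> complex"
  define fU where "fU \<rho> = (\<rho> 0 * \<rho> 1 - \<rho> 2) * (\<rho> 6 * \<rho> 7 - \<rho> 8) * \<rho> 2 * \<rho> 5"
    for \<rho> :: "nat \<Rightarrow> complex"
  define fW where "fW \<rho> = (\<rho> 0 * \<rho> 1 - \<rho> 2) * (\<rho> 6 * \<rho> 7 - \<rho> 8) * \<rho> 5 * \<rho> 8"
    for \<rho> :: "nat \<Rightarrow> complex"
  have hD: "has_value id \<rho> ?\<Delta> (D \<rho>)" and hu: "has_value id \<rho> ?u (fu \<rho>)"
    and hU: "has_value id \<rho> ?U (fU \<rho>)" and hW: "has_value id \<rho> ?W (fW \<rho>)" for \<rho>
    unfolding D_def fu_def fU_def fW_def
    by (intro id_embedding.has_value_arith has_value_t9_den)+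
  obtain u U W where reg: "has_value id \<sigma> (?u / ?\<Delta>) u" "has_value id \<sigma> (?U / ?\<Delta>) U"
    "has_value id \<sigma> (?W / ?\<Delta>) W"
    using reg by (auto simp: map_at_eq_Some_iff T9_eq_t9 t9_def Let_def list_all2_Cons1 \<sigma>_def)
  have \<Delta>: "?\<Delta> \<noteq> 0"
    using T9_denominators(3) by (simp add: t9_den_def)
  \<comment> \<open>Expansion along the line through \<open>\<sigma>\<close> in direction
    \<open>\<delta>\<close>; \<open>x 0\<close> and \<open>y 0\<close> are the coefficients of order
    \<open>k\<close> of numerator and denominator.\<close>
  have along: "v * y 0 = x 0"
    if "has_value id \<sigma> (f / ?\<Delta>) v" "\<And>\<rho>. has_value id \<rho> f (F \<rho>)"
      "\<And>t. F (\<lambda>i. \<sigma> i + t * \<delta> i) = t ^ k * x t" "\<And>t. D (\<lambda>i. \<sigma> i + t * \<delta> i) = t ^ k * y t"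
      "isCont x 0" "isCont y 0" for f v F \<delta> k x y
  proof (rule has_value_divide_along_curve[OF that(1) \<Delta>])
    show "((\<lambda>t. \<sigma> i + t * \<delta> i) \<longlongrightarrow> \<sigma> i) (at 0)" for i
      by (auto intro!: tendsto_eq_intros)
    show "has_value id (\<lambda>i. \<sigma> i + t * \<delta> i) f (t ^ k * x t)"
      "has_value id (\<lambda>i. \<sigma> i + t * \<delta> i) ?\<Delta> (t ^ k * y t)" for t
      using that(2)[of "\<lambda>i. \<sigma> i + t * \<delta> i"] hD[of "\<lambda>i. \<sigma> i + t * \<delta> i"] unfolding that(3,4) .
  qed (use that in auto)
  have at_\<sigma>: "v * D \<sigma> = F \<sigma>"
    if "has_value id \<sigma> (f / ?\<Delta>) v" "\<And>\<rho>. has_value id \<rho> f (F \<rho>)" for f v F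
    by (rule id_embedding.has_value_divide_unique[OF that hD \<Delta>])
  \<comment> \<open>At a zero of \<open>\<Delta>\<close>, regularity forces the numerators of
    \<open>u2\<close>, \<open>U\<close>, \<open>W\<close> to vanish.\<close>
  have zero: "X * Y = 0" "Y * Z = 0" "y2 * z1 * X + x2 * Z = 0"
    using at_\<sigma>[OF reg(1) hu] at_\<sigma>[OF reg(2) hU] at_\<sigma>[OF reg(3) hW] nz
    by (auto simp: D_def fu_def fU_def fW_def \<sigma> D0)
  define e :: "nat \<Rightarrow> nat \<Rightarrow> complex" where "e i = (\<lambda>_. 0)(i := 1)" for i
  note simps = D_def fu_def fU_def fW_def \<sigma> e_def
  let ?dX = "y1 * y2 * z1 * (x1 * y2 + z2) - (x1 * y2 * z1 + z1 * z2 - Z) * Y"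
    and ?dY = "- (x1 * y2 * z1 + z1 * z2 - Z) * X - x1 * x2 * Z"
    and ?dZ = "X * Y + x2 * (y1 * z2 + x1 * (y1 * y2 - Y))"
    and ?dx2 = "(y1 * z2 + x1 * (y1 * y2 - Y)) * Z"
    and ?dz1 = "(x1 * y2 + z2) * X * (y1 * y2 - Y)"
  have dX: "D (\<lambda>i. \<sigma> i + t * e 2 i) = t ^ 1 * ?dX" and dY: "D (\<lambda>i. \<sigma> i + t * e 5 i) = t ^ 1 * ?dY"
    and dZ: "D (\<lambda>i. \<sigma> i + t * e 8 i) = t ^ 1 * ?dZ" and dx2: "D (\<lambda>i. \<sigma> i + t * e 1 i) = t ^ 1 * ?dx2"
    and dz1: "D (\<lambda>i. \<sigma> i + t * e 6 i) = t ^ 1 * ?dz1" for t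
    by (simp_all add: D_def \<sigma> e_def t9_den_add D0 del: One_nat_def)
  consider "Y \<noteq> 0" "X = 0" "Z = 0" | "Y = 0" "X \<noteq> 0" | "Y = 0" "Z \<noteq> 0" | "Y = 0" "X = 0" "Z = 0"
    using zero by auto
  then show False
  proof cases
    case 1
    \<comment> \<open>The first identity gives \<open>?dX \<noteq> 0\<close>, the second then
      \<open>W = 0\<close>, contradicting the third.\<close>
    have "U * ?dX = x1 * x2 * (z1 * z2) * Y"
      using along[OF reg(2) hU, of "e 2" 1 "\<lambda>t. (x1 * x2 - t) * (z1 * z2) * Y", OF _ dX] 1
      by (simp add: simps)
    moreover have "W * ?dX = 0"
      using along[OF reg(3) hW, of "e 2" 1 "\<lambda>t. 0", OF _ dX] 1
      by (simp add: simps)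
    moreover have "W * ?dZ = x1 * x2 * (z1 * z2) * Y"
      using along[OF reg(3) hW, of "e 8" 1 "\<lambda>t. x1 * x2 * (z1 * z2 - t) * Y", OF _ dZ] 1
      by (simp add: simps)
    ultimately show ?thesis using 1 nz by auto
  next
    case 2
    \<comment> \<open>The first identity gives \<open>U \<noteq> 0\<close>, so
      \<open>?dz1 = 0\<close> by the second. The third then forces \<open>y2 = 0\<close>, against
      \<open>y1 * y2 \<noteq> Y\<close> with \<open>Y = 0\<close>.\<close>
    have "U * ?dY = (x1 * x2 - X) * (z1 * z2 - Z) * X"
      using along[OF reg(2) hU, of "e 5" 1 "\<lambda>t. (x1 * x2 - X) * (z1 * z2 - Z) * X", OF _ dY] 2
      by (simp add: simps)
    moreover have "U * ?dz1 = 0"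
      using along[OF reg(2) hU, of "e 6" 1 "\<lambda>t. 0", OF _ dz1] 2
      by (simp add: simps)
    moreover have "u * ?dz1 = (x1 * x2 - X) * (y2 * X) * (z1 * z2 - Z)"
    proof -
      have "y2 * (z1 + t) * X + x2 * Z = t * (y2 * X)" for t
        using zero(3) by algebra
      then show ?thesis
        using along[OF reg(1) hu, of "e 6" 1 "\<lambda>t. (x1 * x2 - X) * (y2 * X) * ((z1 + t) * z2 - Z)", OF _ dz1]
        by (simp add: simps)
    qed
    ultimately show ?thesis using 2 nz by auto
  next
    case 3
    \<comment> \<open>Likewise \<open>W \<noteq> 0\<close>, so \<open>?dx2 = 0\<close>, while the
      right side of the third identity is nonzero.\<close>
    have "W * ?dY = (x1 * x2 - X) * (z1 * z2 - Z) * Z"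
      using along[OF reg(3) hW, of "e 5" 1 "\<lambda>t. (x1 * x2 - X) * (z1 * z2 - Z) * Z", OF _ dY] 3
      by (simp add: simps)
    moreover have "W * ?dx2 = 0"
      using along[OF reg(3) hW, of "e 1" 1 "\<lambda>t. 0", OF _ dx2] 3
      by (simp add: simps)
    moreover have "u * ?dx2 = (x1 * x2 - X) * Z * (z1 * z2 - Z)"
    proof -
      have "y2 * z1 * X + (x2 + t) * Z = t * Z" for t
        using zero(3) by algebra
      then show ?thesis
        using along[OF reg(1) hu, of "e 1" 1 "\<lambda>t. (x1 * (x2 + t) - X) * Z * (z1 * z2 - Z)", OF _ dx2]
        by (simp add: simps del: One_nat_def)
    qed
    ultimately show ?thesis using 3 nz by auto
  next
    case 4
    have "u * ?dZ = x1 * x2 * x2 * (z1 * z2)"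
      using along[OF reg(1) hu, of "e 8" 1 "\<lambda>t. x1 * x2 * x2 * (z1 * z2 - t)", OF _ dZ] 4
      by (simp add: simps)
    moreover have "U * ?dZ = 0"
      using along[OF reg(2) hU, of "e 8" 1 "\<lambda>t. 0", OF _ dZ] 4
      by (simp add: simps)
    moreover
    \<comment> \<open>The two identities above give \<open>?dZ \<noteq> 0\<close> and
      \<open>U = 0\<close>. In direction \<open>\<delta>\<close> the linear terms of
      \<open>\<Delta>\<close> cancel, while the numerator of \<open>U\<close> has a nonzero
      coefficient at \<open>t ^ 2\<close>, which excludes \<open>U = 0\<close>.\<close>
    define \<delta> where "\<delta> = (\<lambda>_::nat. 0)(2 := x2, 5 := 1, 8 := - y2 * z1)"
    have "fU (\<lambda>i. \<sigma> i + t * \<delta> i)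
        = t ^ 2 * ((x1 * x2 - t * x2) * (z1 * z2 + t * (y2 * z1)) * x2)" for t
      using 4 by (simp add: fU_def \<sigma> \<delta>_def power2_eq_square)
    moreover have "D (\<lambda>i. \<sigma> i + t * \<delta> i)
        = t ^ 2 * (x1 * x2 * y2 * z1 - x2 * (x1 * y2 * z1 + z1 * z2 + y2 * z1 * t))" for t
      using 4 by (simp add: D_def t9_den_def \<sigma> \<delta>_def power2_eq_square algebra_simps)
    ultimately show ?thesis
      using along[OF reg(2) hU, of \<delta> 2 "\<lambda>t. (x1 * x2 - t * x2) * (z1 * z2 + t * (y2 * z1)) * x2"
        "\<lambda>t. x1 * x2 * y2 * z1 - x2 * (x1 * y2 * z1 + z1 * z2 + y2 * z1 * t)"] 4 nz
      by auto
  qed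
qed

lemma restricts_to_T9:
  assumes nz: "a \<noteq> 0" "b \<noteq> 0" "c \<noteq> 0"
  shows "restricts_to T9 (leaf_product a b c) leaf_coords (T6 a b c)"
  unfolding restricts_to_def
proof (intro conjI ballI allI impI)
  have "[0, 0, a, 0, 0, b, 0, 0, c] \<in> leaf_product a b c"
    by (simp add: leaf_product_def leaf_def)
  moreover have "map_at T9 [0, 0, a, 0, 0, b, 0, 0, c] \<noteq> None"
    using nz by (subst map_at_T9) (auto simp: t9_den_def)
  ultimately show "\<exists>p\<in>leaf_product a b c. map_at T9 p \<noteq> None" by blast
next
  fix p q assume p: "p \<in> leaf_product a b c" and q: "map_at T9 p = Some q"
  obtain x1 x2 y1 y2 z1 z2 where
    p: "p = [x1, x2, a + x1 * x2, y1, y2, b + y1 * y2, z1, z2, c + z1 * z2]"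
    using p by (auto simp: leaf_product_def leaf_def)
  obtain u1 u2 v1 v2 w1 w2 where t: "t6 a b c x1 x2 y1 y2 z1 z2 = [u1, u2, v1, v2, w1, w2]"
    unfolding t6_def by blast
  \<comment> \<open>Only regularity at \<open>p\<close> is given, so the denominator has to be shown
    nonzero before the formulas can be evaluated. On the leaves the required differences are
    \<open>- a\<close>, \<open>- b\<close>, \<open>- c\<close>.\<close>
  have den: "t6_den a b c x1 x2 y1 y2 z1 z2 \<noteq> 0"
    unfolding t9_den_leaf[symmetric]
    by (rule T9_regular_imp_den_nonzero) (use nz q p in auto)
  have "map_at T9 p = Some [u1, u2, a + u1 * u2, v1, v2, b + v1 * v2, w1, w2, c + w1 * w2]"
    unfolding p t9_leaf[OF nz(1,3) den t, symmetric]
    by (rule map_at_T9) (use nz den in \<open>auto simp: t9_den_leaf\<close>)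
  with q have q: "q = [u1, u2, a + u1 * u2, v1, v2, b + v1 * v2, w1, w2, c + w1 * w2]"
    by simp
  then show "q \<in> leaf_product a b c"
    by (simp add: leaf_product_def leaf_def)
  let ?\<rho> = "(!) [x1, x2, y1, y2, z1, z2]"
  have "list_all2 (has_value id ?\<rho>) (T6 a b c)
      (t6 (id a) (id b) (id c) (?\<rho> 0) (?\<rho> 1) (?\<rho> 2) (?\<rho> 3) (?\<rho> 4) (?\<rho> 5))"
    unfolding T6_eq_t6
    by (intro id_embedding.has_value_t6 id_embedding.has_value_var) (use nz den in auto)
  then show "map_at (T6 a b c) (leaf_coords p) = Some (leaf_coords q)"
    by (simp add: map_at_eq_Some_iff leaf_coords_def p q t)
qed


theorem theorem4p2:
  shows "(invariant_of \<Phi>9 T9 \<and> invariant_of \<Psi>9 T9 \<and> invariant_of \<Omega>9 T9)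
    \<and> ((\<forall>a b c. a \<noteq> 0 \<and> b \<noteq> 0 \<and> c \<noteq> 0 \<longrightarrow>
          restricts_to T9 (leaf_product a b c) leaf_coords (T6 a b c)
          \<and> noninvolutive 6 (T6 a b c))
       \<and> parametric_tetrahedron_map (- {0}) T6)
    \<and> (\<forall>a b c. a \<noteq> 0 \<and> b \<noteq> 0 \<and> c \<noteq> 0 \<longrightarrow>
          invariant_of (I1 a b c) (T6 a b c)
          \<and> invariant_of (I2 a b c) (T6 a b c)
          \<and> invariant_of (I3 a b c) (T6 a b c))"
proof -
  have "parametric_tetrahedron_map (- {0}) T6"
    unfolding parametric_tetrahedron_map_def
    by (intro conjI ballI is_ratmap_T6 tetrahedron_T6) auto
  then show ?thesis
    by (auto intro: T9_invariant_of restricts_to_T9 noninvolutive_T6 T6_invariant_of)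
qed

end
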